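(* Let $f=h+\overline{g}$ be a harmonic mapping of the unit disk $\mathbb{D}$ with $\lambda(z)=|h'(z)|+|g'(z)|\neq0$ and dilatation $g'/h'=q^2$ for some meromorphic function $q$ on $\mathbb{D}$, and let $\widetilde f$ be its canonical (Weierstrass–Enneper) lift to a minimal surface. Suppose that for some extremal Nehari function $p$, $$|\mathcal{S}f(z)|+\lambda(z)^2\,|K(\widetilde f(z))|\le 2p(|z|),\qquad z\in\mathbb{D}.$$ Then $$|\widetilde f(z_1)-\widetilde f(z_2)|\ \ge\ \left\{\frac{\lambda(z_1)\lambda(z_2)}{F'(|z_1|)F'(|z_2|)}\right\}^{1/2} d(z_1,z_2),\qquad z_1,z_2\in\mathbb{D},$$ where $F(x)=\int_0^x u_0(t)^{-2}\,dt$ with $u_0$ the solution of $u''+pu=0$, $u_0(0)=1$, $u_0'(0)=0$.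
   Context: A harmonic mapping of $\mathbb{D}$ is a complex-valued harmonic function, written canonically as $f=h+\overline g$ with $h,g$ analytic in $\mathbb{D}$, $g(0)=0$. When $\lambda=|h'|+|g'|\neq0$ and $g'/h'=q^2$ with $q$ meromorphic, the canonical lift is $\widetilde f=(U,V,W):\mathbb{D}\to\mathbb{R}^3$ with $U=\mathrm{Re} f$, $V=\mathrm{Im} f$, $W(z)=2\,\mathrm{Im}\int_0^z h'(\zeta)q(\zeta)\,d\zeta$; its image is a minimal surface $\Sigma$ with first fundamental form $\lambda^2|dz|^2$ and Gauss curvature $K(\widetilde f(z))=-\lambda(z)^{-2}\Delta(\log\lambda)(z)$. The Schwarzian of such $f$ is $\mathcal{S}f=2(\sigma_{zz}-\sigma_z^2)$ with $\sigma=\log\lambda$ and $\sigma_z=\frac12(\sigma_x-i\sigma_y)$. A Nehari function is a positive continuous even function $p$ on $(-1,1)$ such that $(1-x^2)^2p(x)$ is nonincreasing on $[0,1)$ and no nontrivial solution of $u''+pu=0$ has more than one zero in $(-1,1)$; it is extremal if $cp$ is not a Nehari function for any constant $c>1$. The hyperbolic distance is normalized as $d(z_1,z_2)=\tfrac12\log\frac{1+\delta}{1-\delta}$ with $\delta=\left|\frac{z_1-z_2}{1-\overline{z_1}z_2}\right|$ (so that $d(x_1,x_2)=\left|\int_{x_1}^{x_2}\frac{dx}{1-x^2}\right|$ on $(-1,1)$). *)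

theory Defs
  imports "HOL-Analysis.Analysis"
begin

definition px :: "(complex \<Rightarrow> 'a::real_normed_vector) \<Rightarrow> complex \<Rightarrow> 'a" where
  "px v z = vector_derivative (\<lambda>t::real. v (z + complex_of_real t)) (at 0)"

definition py :: "(complex \<Rightarrow> 'a::real_normed_vector) \<Rightarrow> complex \<Rightarrow> 'a" where
  "py v z = vector_derivative (\<lambda>t::real. v (z + \<i> * complex_of_real t)) (at 0)"

definition laplacian :: "(complex \<Rightarrow> real) \<Rightarrow> complex \<Rightarrow> real" where
  "laplacian u z = px (px u) z + py (py u) z"

definition dz :: "(complex \<Rightarrow> complex) \<Rightarrow> complex \<Rightarrow> complex" where
  "dz v z = (px v z - \<i> * py v z) / 2"

definition harm_lambda :: "(complex \<Rightarrow> complex) \<Rightarrow> (complex \<Rightarrow> complex) \<Rightarrow> complex \<Rightarrow> real" where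
  "harm_lambda h g z = cmod (deriv h z) + cmod (deriv g z)"

definition harm_sigma :: "(complex \<Rightarrow> complex) \<Rightarrow> (complex \<Rightarrow> complex) \<Rightarrow> complex \<Rightarrow> real" where
  "harm_sigma h g z = ln (harm_lambda h g z)"

definition harm_schwarzian :: "(complex \<Rightarrow> complex) \<Rightarrow> (complex \<Rightarrow> complex) \<Rightarrow> complex \<Rightarrow> complex" where
  "harm_schwarzian h g z =
     (let sz = dz (\<lambda>w. complex_of_real (harm_sigma h g w))
      in 2 * (dz sz z - (sz z)\<^sup>2))"

text \<open>Gauss curvature of the lifted minimal surface at the point lift(z):
  K = - lambda^(-2) * Laplacian(log lambda).\<close>
definition gauss_curvature :: "(complex \<Rightarrow> complex) \<Rightarrow> (complex \<Rightarrow> complex) \<Rightarrow> complex \<Rightarrow> real" where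
  "gauss_curvature h g z = - laplacian (harm_sigma h g) z / (harm_lambda h g z)\<^sup>2"

definition meromorphic_disk :: "(complex \<Rightarrow> complex) \<Rightarrow> complex set \<Rightarrow> bool" where
  "meromorphic_disk q P \<longleftrightarrow> P \<subseteq> ball 0 1 \<and> (\<forall>z\<in>ball 0 1. \<not> z islimpt P) \<and>
     q holomorphic_on (ball 0 1 - P) \<and> (\<forall>w\<in>P. filterlim q at_infinity (at w))"

text \<open>Canonical lift (U, V, W) with W = 2 Im Phi, Phi the primitive of h' q with Phi 0 = 0.\<close>
definition harm_lift :: "(complex \<Rightarrow> complex) \<Rightarrow> (complex \<Rightarrow> complex) \<Rightarrow> (complex \<Rightarrow> complex) \<Rightarrow> complex \<Rightarrow> real^3" where
  "harm_lift h g \<Phi> z = vector [Re (h z + cnj (g z)), Im (h z + cnj (g z)), 2 * Im (\<Phi> z)]"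

definition hyp_dist :: "complex \<Rightarrow> complex \<Rightarrow> real" where
  "hyp_dist z1 z2 = (let \<delta> = cmod ((z1 - z2) / (1 - cnj z1 * z2)) in ln ((1 + \<delta>) / (1 - \<delta>)) / 2)"

definition ode_solution :: "(real \<Rightarrow> real) \<Rightarrow> (real \<Rightarrow> real) \<Rightarrow> bool" where
  "ode_solution p u \<longleftrightarrow> (\<exists>u'. \<forall>x\<in>{-1<..<1}.
      (u has_real_derivative u' x) (at x) \<and> (u' has_real_derivative (- p x * u x)) (at x))"

definition nehari_function :: "(real \<Rightarrow> real) \<Rightarrow> bool" where
  "nehari_function p \<longleftrightarrow>
     (\<forall>x\<in>{-1<..<1}. p x > 0) \<and> continuous_on {-1<..<1} p \<and>
     (\<forall>x\<in>{-1<..<1}. p (- x) = p x) \<and>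
     (\<forall>x y. 0 \<le> x \<and> x \<le> y \<and> y < 1 \<longrightarrow> (1 - y\<^sup>2)\<^sup>2 * p y \<le> (1 - x\<^sup>2)\<^sup>2 * p x) \<and>
     (\<forall>u. ode_solution p u \<and> (\<exists>x\<in>{-1<..<1}. u x \<noteq> 0) \<longrightarrow>
        \<not> (\<exists>a b. -1 < a \<and> a < b \<and> b < 1 \<and> u a = 0 \<and> u b = 0))"

definition extremal_nehari :: "(real \<Rightarrow> real) \<Rightarrow> bool" where
  "extremal_nehari p \<longleftrightarrow> nehari_function p \<and> (\<forall>c>1. \<not> nehari_function (\<lambda>x. c * p x))"

definition nehari_F :: "(real \<Rightarrow> real) \<Rightarrow> real \<Rightarrow> real" where
  "nehari_F u0 x = (if 0 \<le> x then integral {0..x} (\<lambda>t. 1 / (u0 t)\<^sup>2)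
                    else - integral {x..0} (\<lambda>t. 1 / (u0 t)\<^sup>2))"

end

theory Submission
  imports Defs "HOL-Complex_Analysis.Complex_Analysis"
begin

text \<open>Join two points by a hyperbolic geodesic, parametrized by arc length \<open>s\<close> from its point closest
  to the origin, so that \<open>|\<gamma> s| \<ge> |tanh s|\<close>. In this variable \<open>u'' + p u = 0\<close> becomes
  \<open>U'' = (1 - k) U\<close> with \<open>k s = (1 - x\<^sup>2)\<^sup>2 p x\<close>, \<open>x = tanh s\<close>, and the monotonicity of \<open>k\<close> turns the
  hypothesis into a bound \<open>k - 1\<close> on the Schwarzian of the lifted curve \<open>\<psi>\<close>. Dividing the chord length
  from a fixed point by \<open>|\<psi>'|\<^sup>1\<^sup>/\<^sup>2\<close> gives a function \<open>y\<close> with \<open>y'' \<ge> (1 - k) y\<close>, to be compared with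
  the solution \<open>W\<close> that corresponds to \<open>u\<^sub>0\<close>. Extremality of \<open>p\<close> forces \<open>W\<close> to decrease in \<open>|s|\<close>; this
  yields \<open>W \<le> 1\<close> and the passage from \<open>W s\<close> to \<open>u\<^sub>0 |\<gamma> s|\<close>.\<close>

section \<open>The differential equation in the hyperbolic variable\<close>

text \<open>The distance in the conclusion is a parameter length: the Wronskian
  \<open>Q = W y' - W' y\<close> is nondecreasing and \<open>(y / W)' = Q / W^2\<close>, so
  \<open>W \<le> 1\<close> keeps this slope above the initial value of \<open>Q\<close>, and
  \<open>y / W\<close> grows at least linearly. Extremality cannot be spared here: for a small
  constant \<open>p\<close> the function \<open>cosh s * u0 (tanh s)\<close> is unbounded. The
  combination in the hypothesis is what the Schwarzian of the lifted curve produces. Its tangential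
  part gives the real part of the surface Schwarzian, one copy of the curvature term, and minus a
  square measuring the geodesic curvature of the curve in the surface. Its normal part gives that
  square back, plus at most a second copy of the curvature term. The \<open>-1\<close> in
  \<open>k - 1\<close> is half the Schwarzian of the hyperbolic parametrization, which is
  \<open>-2\<close> on every geodesic. The chord function vanishes at its base point and might
  vanish again, so the comparison runs only up to the next zero and thereby excludes it.\<close>

lemma one_minus_tanh_sq: "1 - (tanh s)\<^sup>2 = 1 / (cosh (s::real))\<^sup>2"
proof -
  have "(cosh s)\<^sup>2 \<noteq> 0" by simp
  then show ?thesis
    by (simp add: tanh_def power_divide divide_simps sinh_square_eq)
qed

lemma tanh_artanh_real: "tanh (artanh x) = x" if "\<bar>x\<bar> < 1" for x :: real
proof -
  have x: "(1 + x) / (1 - x) > 0" using that by (auto simp: abs_less_iff)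
  then have "artanh x = ln (sqrt ((1 + x) / (1 - x)))"
    by (simp add: artanh_def ln_sqrt)
  also have "tanh \<dots> = ((1 + x) / (1 - x) - 1) / ((1 + x) / (1 - x) + 1)"
    using x by (subst tanh_ln_real) simp_all
  also have "\<dots> = x" using that by (simp add: divide_simps abs_less_iff)
  finally show ?thesis .
qed

text \<open>Liouville's change of variable: with \<open>x = tanh s\<close> the solution is divided
  by the square root of \<open>dx/ds = 1 / (cosh s)^2\<close>. The summand \<open>1\<close> in the
  new coefficient is minus half the Schwarzian of \<open>tanh\<close>.\<close>

lemma ode_to_hyperbolic:
  fixes p u u' :: "real \<Rightarrow> real"
  assumes "\<And>x. \<bar>x\<bar> < 1 \<Longrightarrow> (u has_real_derivative u' x) (at x)"
    and "\<And>x. \<bar>x\<bar> < 1 \<Longrightarrow> (u' has_real_derivative (- p x * u x)) (at x)"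
  defines "U \<equiv> \<lambda>s. cosh s * u (tanh s)"
    and "U1 \<equiv> \<lambda>s. sinh s * u (tanh s) + u' (tanh s) / cosh s"
  shows "(U has_real_derivative U1 s) (at s)"
    and "(U1 has_real_derivative (1 - (1 - (tanh s)\<^sup>2)\<^sup>2 * p (tanh s)) * U s) (at s)"
proof -
  have t: "\<bar>tanh s\<bar> < 1" using tanh_real_gt_neg1[of s] tanh_real_lt_1[of s] by linarith
  have dt: "(tanh has_real_derivative 1 / (cosh s)\<^sup>2) (at s)"
    unfolding one_minus_tanh_sq[symmetric]
    by (auto intro!: derivative_eq_intros)
  have d1: "((\<lambda>s. u (tanh s)) has_real_derivative u' (tanh s) * (1 / (cosh s)\<^sup>2)) (at s)"
    by (rule DERIV_chain2[OF assms(1)[OF t] dt])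
  have d2: "((\<lambda>s. u' (tanh s)) has_real_derivative (- p (tanh s) * u (tanh s)) * (1 / (cosh s)\<^sup>2)) (at s)"
    by (rule DERIV_chain2[OF assms(2)[OF t] dt])
  show "(U has_real_derivative U1 s) (at s)"
    unfolding U_def U1_def
    by (rule derivative_eq_intros d1 refl)+ (simp add: divide_simps power2_eq_square)
  show "(U1 has_real_derivative (1 - (1 - (tanh s)\<^sup>2)\<^sup>2 * p (tanh s)) * U s) (at s)"
    unfolding U_def U1_def one_minus_tanh_sq
    by (rule derivative_eq_intros d1 d2 refl | simp)+ (simp add: divide_simps power2_eq_square, simp add: algebra_simps)
qed

section \<open>Zeros of solutions on the whole line\<close>

text \<open>Gronwall argument for uniqueness: \<open>E = U^2 + U1^2\<close> satisfies
  \<open>\<bar>E'\<bar> \<le> (1 + K) E\<close>, so an exponential factor makes \<open>E\<close>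
  monotone on either side of \<open>a\<close>, where it vanishes. Only boundedness of
  \<open>r\<close> enters.\<close>

lemma linear_ode_zero:
  fixes U U1 :: "real \<Rightarrow> real"
  assumes "\<And>s. (U has_real_derivative U1 s) (at s)"
    and "\<And>s. (U1 has_real_derivative r s * U s) (at s)"
    and "\<And>s. \<bar>r s\<bar> \<le> K" "U a = 0" "U1 a = 0"
  shows "U s = 0"
proof -
  define E where "E s = (U s)\<^sup>2 + (U1 s)\<^sup>2" for s
  have dE: "(E has_real_derivative 2 * (1 + r s) * (U s * U1 s)) (at s)" for s
    unfolding E_def by (rule derivative_eq_intros assms refl)+ (simp add: algebra_simps)
  have bd: "\<bar>2 * (1 + r s) * (U s * U1 s)\<bar> \<le> (1 + K) * E s" for s
  proof -
    have 1: "2 * \<bar>U s * U1 s\<bar> \<le> E s"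
      using sum_squares_bound[of "\<bar>U s\<bar>" "\<bar>U1 s\<bar>"] by (simp add: E_def abs_mult)
    have "\<bar>1 + r s\<bar> \<le> 1 + K" using assms(3)[of s] by linarith
    then have "\<bar>1 + r s\<bar> * (2 * \<bar>U s * U1 s\<bar>) \<le> (1 + K) * E s"
      using assms(3)[of s] 1 by (intro mult_mono) auto
    moreover have "\<bar>2 * (1 + r s) * (U s * U1 s)\<bar> = \<bar>1 + r s\<bar> * (2 * \<bar>U s * U1 s\<bar>)"
      by (simp only: abs_mult)
    ultimately show ?thesis by simp
  qed
  have E0: "E a = 0" by (simp add: E_def assms)
  have "E s \<le> 0"
  proof (cases "a \<le> s")
    case True
    have "E s * exp (- ((1 + K) * s)) \<le> E a * exp (- ((1 + K) * a))"
    proof (rule DERIV_nonpos_imp_nonincreasing[OF True], goal_cases)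
      case (1 x)
      have "((\<lambda>s. E s * exp (- ((1 + K) * s))) has_real_derivative
          (2 * (1 + r x) * (U x * U1 x) - (1 + K) * E x) * exp (- ((1 + K) * x))) (at x)"
        by (rule derivative_eq_intros dE refl)+ (simp add: algebra_simps)
      moreover have "(2 * (1 + r x) * (U x * U1 x) - (1 + K) * E x) * exp (- ((1 + K) * x)) \<le> 0"
        using bd[of x] by (intro mult_nonpos_nonneg) auto
      ultimately show ?case by blast
    qed
    then show ?thesis by (simp add: E0 mult_le_0_iff)
  next
    case False
    have "E s * exp ((1 + K) * s) \<le> E a * exp ((1 + K) * a)"
    proof (rule DERIV_nonneg_imp_nondecreasing[where f="\<lambda>s. E s * exp ((1 + K) * s)"], goal_cases)
      case (2 x)
      have "((\<lambda>s. E s * exp ((1 + K) * s)) has_real_derivative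
          (2 * (1 + r x) * (U x * U1 x) + (1 + K) * E x) * exp ((1 + K) * x)) (at x)"
        by (rule derivative_eq_intros dE refl)+ (simp add: algebra_simps)
      moreover have "(2 * (1 + r x) * (U x * U1 x) + (1 + K) * E x) * exp ((1 + K) * x) \<ge> 0"
        using bd[of x] by (intro mult_nonneg_nonneg) auto
      ultimately show ?case by blast
    qed (use False in auto)
    then show ?thesis by (simp add: E0 mult_le_0_iff)
  qed
  then show ?thesis by (simp add: E_def sum_power2_le_zero_iff)
qed

text \<open>A Riccati supersolution \<open>\<rho>\<close> makes \<open>U (U' - \<rho> U)\<close> nondecreasing; the expression
  vanishes at the zeros of \<open>U\<close>.\<close>
lemma riccati_disconjugate:
  fixes U U1 :: "real \<Rightarrow> real"
  assumes U: "\<And>s. (U has_real_derivative U1 s) (at s)"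
    and U1: "\<And>s. (U1 has_real_derivative r s * U s) (at s)"
    and r: "\<And>s. \<bar>r s\<bar> \<le> K"
    and \<rho>: "\<And>s. (\<rho> has_real_derivative \<rho>' s) (at s)"
    and ric: "\<And>s. \<rho>' s + (\<rho> s)\<^sup>2 \<le> r s"
    and ab: "a < b" "U a = 0" "U b = 0"
  shows "U s = 0"
proof -
  define Q where "Q s = U s * (U1 s - \<rho> s * U s)" for s
  define Q' where "Q' s = (U1 s - \<rho> s * U s)\<^sup>2 + (U s)\<^sup>2 * (r s - \<rho>' s - (\<rho> s)\<^sup>2)" for s
  have dQ: "(Q has_real_derivative Q' s) (at s)" for s
    unfolding Q_def Q'_def
    by (rule derivative_eq_intros U U1 \<rho> refl)+ (simp add: algebra_simps power2_eq_square)
  have Q'0: "Q' s \<ge> 0" for s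
    unfolding Q'_def using ric[of s] by (intro add_nonneg_nonneg mult_nonneg_nonneg) auto
  have mono: "Q x \<le> Q y" if "x \<le> y" for x y
    using DERIV_nonneg_imp_nondecreasing[OF that] dQ Q'0 by blast
  \<comment> \<open>A zero with nonzero slope would make \<open>Q\<close> strictly larger just after
    \<open>a\<close>, although \<open>Q\<close> is nondecreasing and vanishes at both
    \<open>a\<close> and \<open>b\<close>.\<close>
  have "U1 a = 0"
  proof (rule ccontr)
    assume "U1 a \<noteq> 0"
    then have "Q' a > 0" by (simp add: Q'_def ab)
    from DERIV_pos_inc_right[OF dQ this] obtain d where d: "d > 0" "\<And>h. 0 < h \<Longrightarrow> h < d \<Longrightarrow> Q a < Q (a + h)"
      by blast
    define h where "h = min (d/2) (b - a)"
    have "Q a < Q (a + h)" using d ab by (auto simp: h_def)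
    also have "\<dots> \<le> Q b" by (rule mono) (auto simp: h_def)
    finally show False by (simp add: Q_def ab)
  qed
  from linear_ode_zero[OF U U1 r ab(2) this] show ?thesis .
qed

section \<open>Consequences of the Nehari conditions\<close>

text \<open>The solution splits into an even part \<open>v\<close> and an odd part \<open>w\<close>.
  A zero of \<open>v\<close> would come with its mirror image, against disconjugacy. Since
  \<open>w\<close> has zero initial data, its Wronskian with the positive \<open>v\<close> vanishes,
  so \<open>w / v\<close> is constant. This route to uniqueness asks for no bound on
  \<open>p\<close>, which may blow up at the endpoints.\<close>

lemma nehari_even_solution:
  fixes p u u' :: "real \<Rightarrow> real"
  assumes p: "nehari_function p"
    and u: "\<And>x. \<bar>x\<bar> < 1 \<Longrightarrow> (u has_real_derivative u' x) (at x)"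
    and u': "\<And>x. \<bar>x\<bar> < 1 \<Longrightarrow> (u' has_real_derivative (- p x * u x)) (at x)"
    and u0: "u 0 = 1" "u' 0 = 0"
    and x: "\<bar>x\<bar> < 1"
  shows "u x > 0" "u (- x) = u x"
proof -
  define v where "v x = (u x + u (- x)) / 2" for x
  define v' where "v' x = (u' x - u' (- x)) / 2" for x
  define w where "w x = (u x - u (- x)) / 2" for x
  define w' where "w' x = (u' x + u' (- x)) / 2" for x
  have even: "p (- x) = p x" if "\<bar>x\<bar> < 1" for x
    using p that by (simp add: nehari_function_def abs_less_iff)
  have um: "((\<lambda>x. u (- x)) has_real_derivative - u' (- x)) (at x)" if "\<bar>x\<bar> < 1" for x
    using u[of "- x"] that by (simp add: DERIV_mirror[symmetric])
  have um': "((\<lambda>x. u' (- x)) has_real_derivative p x * u (- x)) (at x)" if "\<bar>x\<bar> < 1" for x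
    using u'[of "- x"] that even[OF that]
    by (simp add: DERIV_mirror[where y="- (p x * u (- x))", simplified, symmetric])
  have v: "(v has_real_derivative v' x) (at x)" if "\<bar>x\<bar> < 1" for x
    unfolding v_def v'_def by (rule derivative_eq_intros u um that refl | simp)+
  have v': "(v' has_real_derivative (- p x * v x)) (at x)" if "\<bar>x\<bar> < 1" for x
    unfolding v_def v'_def
    by (rule derivative_eq_intros u' um' that refl | simp)+ (simp add: field_simps)
  have w: "(w has_real_derivative w' x) (at x)" if "\<bar>x\<bar> < 1" for x
    unfolding w_def w'_def by (rule derivative_eq_intros u um that refl | simp)+
  have w': "(w' has_real_derivative (- p x * w x)) (at x)" if "\<bar>x\<bar> < 1" for x
    unfolding w_def w'_def
    by (rule derivative_eq_intros u' um' that refl | simp)+ (simp add: field_simps)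
  have v0: "v 0 = 1" "v' 0 = 0" and w0: "w 0 = 0" "w' 0 = 0"
    by (simp_all add: v_def v'_def w_def w'_def u0)
  have "ode_solution p v"
    unfolding ode_solution_def using v v' by (intro exI[of _ v']) auto
  then have disc: "\<not> (v a = 0 \<and> v b = 0)" if "-1 < a" "a < b" "b < 1" for a b
    using p v0 that unfolding nehari_function_def
    by (metis greaterThanLessThan_iff less_numeral_extra(1) neg_less_0_iff_less zero_neq_one)
  have vpos: "v x > 0" if "\<bar>x\<bar> < 1" for x
  proof (rule ccontr)
    assume "\<not> v x > 0"
    moreover have "v \<bar>x\<bar> = v x" by (auto simp: v_def abs_if)
    ultimately have le: "v \<bar>x\<bar> \<le> 0" by simp
    have "continuous_on {0..\<bar>x\<bar>} v"
      using that by (intro continuous_at_imp_continuous_on ballI DERIV_isCont[OF v]) auto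
    with IVT2'[of v "\<bar>x\<bar>" 0 0] le v0 obtain b where b: "0 \<le> b" "b \<le> \<bar>x\<bar>" "v b = 0" by auto
    then have "b > 0" using v0 by (cases "b = 0") auto
    moreover have "v (- b) = 0" using b by (simp add: v_def add.commute)
    ultimately show False using disc[of "- b" b] b that by auto
  qed
  have wz: "w x = 0" if "\<bar>x\<bar> < 1" for x
  proof -
    have wr: "v x * w' x - v' x * w x = v 0 * w' 0 - v' 0 * w 0" if "\<bar>x\<bar> < 1" for x
    proof (rule DERIV_isconst3[of "-1" 1 x 0])
      fix x :: real assume "x \<in> {-1<..<1}"
      then have *: "\<bar>x\<bar> < 1" by auto
      show "((\<lambda>x. v x * w' x - v' x * w x) has_real_derivative 0) (at x)"
        by (rule derivative_eq_intros v v' w w' * refl)+ (simp add: algebra_simps)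
    qed (use that in auto)
    have "w x / v x = w 0 / v 0"
    proof (rule DERIV_isconst3[of "-1" 1 x 0])
      fix x :: real assume "x \<in> {-1<..<1}"
      then have *: "\<bar>x\<bar> < 1" by auto
      show "((\<lambda>x. w x / v x) has_real_derivative 0) (at x)"
        using vpos[OF *] wr[OF *] w0
        by (auto intro!: derivative_eq_intros v w * simp: algebra_simps)
    qed (use that in auto)
    then show ?thesis using w0 vpos[OF that] by simp
  qed
  show "u x > 0" "u (- x) = u x"
    using vpos[OF x] wz[OF x] by (auto simp: v_def w_def)
qed

text \<open>Both branches equal the integral from \<open>a\<close> minus a constant, so the base
  point 0 is not exceptional. The two-branch form is that of \<open>nehari_F\<close>; the same lemma
  yields the primitive \<open>J\<close> of \<open>W^2\<close>.\<close>

lemma has_derivative_integral_from_0: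
  fixes f :: "real \<Rightarrow> real"
  assumes f: "continuous_on {a..b} f" and "a < 0" "0 < b" "a < x" "x < b"
  shows "((\<lambda>x. if 0 \<le> x then integral {0..x} f else - integral {x..0} f)
           has_real_derivative f x) (at x)"
proof -
  have int: "f integrable_on {c..d}" if "a \<le> c" "d \<le> b" for c d
    by (rule integrable_continuous_interval, rule continuous_on_subset[OF f]) (use that in auto)
  have "((\<lambda>x. integral {a..x} f) has_real_derivative f x) (at x within {a..b})"
    using integral_has_real_derivative[OF f, of x] assms by simp
  then have "((\<lambda>x. integral {a..x} f) has_real_derivative f x) (at x)"
    using assms by (simp add: at_within_Icc_at)
  then have "((\<lambda>x. integral {a..x} f - integral {a..0} f) has_real_derivative f x) (at x)"
    by (auto intro!: derivative_eq_intros)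
  then show ?thesis
  proof (rule has_field_derivative_transform_within_open[of _ _ _ "{a<..<b}"])
    fix y assume y: "y \<in> {a<..<b}"
    show "integral {a..y} f - integral {a..0} f = (if 0 \<le> y then integral {0..y} f else - integral {y..0} f)"
    proof (cases "0 \<le> y")
      case True
      then show ?thesis using Henstock_Kurzweil_Integration.integral_combine[of a 0 y f] int[of a y] y assms by auto
    next
      case False
      then show ?thesis using Henstock_Kurzweil_Integration.integral_combine[of a y 0 f] int[of a 0] y assms by auto
    qed
  qed (use assms in auto)
qed

text \<open>The Nehari conditions on \<open>p\<close> make \<open>k\<close> even and largest at 0.
  The resulting bound \<open>p 0\<close> supplies the boundedness of the coefficient that uniqueness
  on the whole line requires, even when \<open>p\<close> is unbounded.\<close>

lemma hyperbolic_weight: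
  fixes p :: "real \<Rightarrow> real"
  assumes p: "nehari_function p"
  defines "k \<equiv> \<lambda>s. (1 - (tanh s)\<^sup>2)\<^sup>2 * p (tanh s)"
  shows "k s > 0" "k (- s) = k s" "\<bar>s\<bar> \<le> \<bar>t\<bar> \<Longrightarrow> k t \<le> k s" "k s \<le> p 0"
proof -
  have t: "\<bar>tanh s\<bar> < 1" for s :: real using tanh_real_gt_neg1[of s] tanh_real_lt_1[of s] by linarith
  show "k s > 0" for s
    using p t[of s] by (auto simp: k_def nehari_function_def one_minus_tanh_sq abs_less_iff)
  show even: "k (- s) = k s" for s
    using p t[of s] by (auto simp: k_def nehari_function_def abs_less_iff)
  have ab: "k \<bar>s\<bar> = k s" for s using even by (auto simp: abs_if)
  show dec: "k t \<le> k s" if "\<bar>s\<bar> \<le> \<bar>t\<bar>" for s t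
  proof -
    have "0 \<le> tanh \<bar>s\<bar>" "tanh \<bar>s\<bar> \<le> tanh \<bar>t\<bar>" "tanh \<bar>t\<bar> < 1"
      using that by (simp_all only: tanh_real_le_iff tanh_real_nonneg_iff tanh_real_lt_1 abs_ge_zero)
    then have "k \<bar>t\<bar> \<le> k \<bar>s\<bar>" using p unfolding k_def nehari_function_def by blast
    then show ?thesis by (simp add: ab)
  qed
  show "k s \<le> p 0" using dec[of 0 s] by (simp add: k_def)
qed

text \<open>If \<open>W'\<close> became positive at some \<open>s1\<close>, then \<open>k < 1\<close> from \<open>s1\<close> on and \<open>W\<close> would grow
  exponentially, so \<open>J / W\<^sup>2\<close> with \<open>J = \<integral>W\<^sup>2\<close> would be bounded. Then \<open>W' / W - \<epsilon> J / W\<^sup>2\<close> is a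
  Riccati supersolution for \<open>c k\<close> with some \<open>c > 1\<close>, against extremality.\<close>
lemma extremal_solution_decreasing:
  fixes p W W1 :: "real \<Rightarrow> real"
  assumes ext: "extremal_nehari p"
    and W: "\<And>s. (W has_real_derivative W1 s) (at s)"
    and W1: "\<And>s. (W1 has_real_derivative (1 - (1 - (tanh s)\<^sup>2)\<^sup>2 * p (tanh s)) * W s) (at s)"
    and pos: "\<And>s. W s > 0" and even: "\<And>s. W (- s) = W s" and W10: "W1 0 = 0" and s1: "0 \<le> s1"
  shows "W1 s1 \<le> 0"
proof (rule ccontr)
  define k where "k s = (1 - (tanh s)\<^sup>2)\<^sup>2 * p (tanh s)" for s
  have p: "nehari_function p" using ext by (simp add: extremal_nehari_def)
  note k = hyperbolic_weight[OF p, folded k_def]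
  note W1 = W1[folded k_def]
  assume "\<not> W1 s1 \<le> 0"
  then have W1s: "W1 s1 > 0" by simp
  \<comment> \<open>Otherwise \<open>k \<ge> 1\<close> on all of \<open>[0, s1]\<close>, so
    \<open>W\<close> is concave there and its slope could not rise above
    \<open>W1 0 = 0\<close>.\<close>
  have ks: "k s1 < 1"
  proof (rule ccontr)
    assume "\<not> k s1 < 1"
    have "W1 s1 \<le> W1 0"
    proof (rule DERIV_nonpos_imp_nonincreasing[OF s1], goal_cases)
      case (1 x)
      then have "k s1 \<le> k x" by (intro k(3)) auto
      then have "(1 - k x) * W x \<le> 0"
        using \<open>\<not> k s1 < 1\<close> pos[of x] by (intro mult_nonpos_nonneg) auto
      then show ?case using W1 by blast
    qed
    then show False using W1s W10 by simp
  qed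
  \<comment> \<open>A growth rate: the first bound starts the inequality \<open>m W \<le> W1\<close>
    at \<open>s1\<close>; the other two give \<open>m * m \<le> 1 - k s1\<close>, which persists
    beyond \<open>s1\<close> because \<open>k\<close> decreases.\<close>
  define m where "m = min (W1 s1 / W s1) (min 1 (1 - k s1))"
  have m: "0 < m" "m * W s1 \<le> W1 s1" "m * m \<le> 1 - k s1"
  proof -
    show m0: "0 < m" using W1s ks pos by (simp add: m_def)
    have "m \<le> W1 s1 / W s1" by (simp add: m_def)
    then show "m * W s1 \<le> W1 s1" using pos[of s1] by (simp add: pos_le_divide_eq)
    have "m * m \<le> 1 * (1 - k s1)" using m0 by (intro mult_mono) (auto simp: m_def)
    then show "m * m \<le> 1 - k s1" by simp
  qed
  have grow: "m * W s \<le> W1 s" if "s1 \<le> s" for s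
  proof -
    have "(W1 s1 - m * W s1) * exp (m * s1) \<le> (W1 s - m * W s) * exp (m * s)"
    proof (rule DERIV_nonneg_imp_nondecreasing[where f="\<lambda>s. (W1 s - m * W s) * exp (m * s)", OF that], goal_cases)
      case (1 x)
      then have "k x \<le> k s1" using s1 by (intro k(3)) auto
      with m(3) have "m * m * W x \<le> (1 - k x) * W x" using pos[of x] by (intro mult_right_mono) auto
      then have "0 \<le> ((1 - k x) * W x - m * m * W x) * exp (m * x)" by simp
      moreover have "((\<lambda>s. (W1 s - m * W s) * exp (m * s)) has_real_derivative
          ((1 - k x) * W x - m * m * W x) * exp (m * x)) (at x)"
        by (rule derivative_eq_intros W W1 refl)+ (simp add: algebra_simps)
      ultimately show ?case by blast
    qed
    moreover have "0 \<le> (W1 s1 - m * W s1) * exp (m * s1)" using m by simp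
    ultimately have "0 \<le> (W1 s - m * W s) * exp (m * s)" by linarith
    then show ?thesis by (simp add: zero_le_mult_iff)
  qed
  have contW: "continuous_on A W" for A
    by (intro continuous_at_imp_continuous_on ballI DERIV_isCont[OF W])
  define J where "J x = (if 0 \<le> x then integral {0..x} (\<lambda>s. (W s)\<^sup>2) else - integral {x..0} (\<lambda>s. (W s)\<^sup>2))" for x
  have J: "(J has_real_derivative (W x)\<^sup>2) (at x)" for x
    unfolding J_def
    by (rule has_derivative_integral_from_0[of "- \<bar>x\<bar> - 1" "\<bar>x\<bar> + 1"]) (auto intro!: continuous_intros contW)
  have J0: "J 0 = 0" by (simp add: J_def)
  have Jodd: "J (- x) = - J x" for x
  proof -
    have "((\<lambda>x. J (- x)) has_real_derivative - (W x)\<^sup>2) (at x)" for x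
      using J[of "- x"] even by (simp add: DERIV_mirror[symmetric])
    then have "\<forall>x. ((\<lambda>x. J (- x) + J x) has_real_derivative 0) (at x)"
      by (auto intro!: derivative_eq_intros J)
    from DERIV_isconst_all[OF this, of x 0] show ?thesis by (simp add: J0)
  qed
  have "continuous_on {0..s1} (\<lambda>x. J x / (W x)\<^sup>2)"
    using pos by (intro continuous_intros contW continuous_at_imp_continuous_on ballI DERIV_isCont[OF J])
      (simp add: less_imp_neq[symmetric])
  then have "bounded ((\<lambda>x. J x / (W x)\<^sup>2) ` {0..s1})"
    by (intro compact_imp_bounded compact_continuous_image) auto
  then obtain B0 where B0: "\<And>x. 0 \<le> x \<Longrightarrow> x \<le> s1 \<Longrightarrow> \<bar>J x / (W x)\<^sup>2\<bar> \<le> B0"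
    by (force simp: bounded_iff)
  \<comment> \<open>\<open>B0\<close> bounds the quotient on the compact interval up to
    \<open>s1\<close>. Beyond it, \<open>2 m B \<ge> 1\<close> makes \<open>B W^2 - J\<close>
    nondecreasing, as \<open>W1 \<ge> m W\<close>. The entry 1 keeps \<open>B\<close> positive for
    the division in \<open>e\<close>.\<close>
  define B where "B = max 1 (max B0 (1 / (2 * m)))"
  have B: "B \<ge> 1" "B \<ge> B0" "1 / (2 * m) \<le> B" by (simp_all add: B_def)
  then have mB: "2 * m * B \<ge> 1" using m(1) by (simp add: pos_divide_le_eq mult_ac)
  have Jmono: "J x \<le> J y" if "x \<le> y" for x y
    by (rule DERIV_nonneg_imp_nondecreasing[OF that]) (use J in force)
  have JB: "J s \<le> B * (W s)\<^sup>2" if "0 \<le> s" for s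
  proof -
    have 1: "J s \<le> B * (W s)\<^sup>2" if "0 \<le> s" "s \<le> s1" for s
    proof -
      have "J s / (W s)\<^sup>2 \<le> B" using B0[OF that] B by linarith
      then show ?thesis using pos[of s] by (simp add: divide_le_eq)
    qed
    show ?thesis
    proof (cases "s \<le> s1")
      case False
      have "B * (W s1)\<^sup>2 - J s1 \<le> B * (W s)\<^sup>2 - J s"
      proof (rule DERIV_nonneg_imp_nondecreasing[where f="\<lambda>s. B * (W s)\<^sup>2 - J s"], goal_cases)
        case (2 x)
        have "(W x)\<^sup>2 \<le> (2 * m * B) * (W x)\<^sup>2" using mB by (simp add: mult_le_cancel_right1)
        also have "\<dots> = 2 * B * (m * W x) * W x" by (simp add: power2_eq_square)
        also have "\<dots> \<le> 2 * B * W1 x * W x"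
          using grow[of x] 2 B(1) pos[of x] by (intro mult_right_mono mult_left_mono) auto
        finally have "0 \<le> 2 * B * W1 x * W x - (W x)\<^sup>2" by simp
        moreover have "((\<lambda>x. B * (W x)\<^sup>2 - J x) has_real_derivative 2 * B * W1 x * W x - (W x)\<^sup>2) (at x)"
          by (rule derivative_eq_intros W J refl)+ simp
        ultimately show ?case by blast
      qed (use False in auto)
      then show ?thesis using 1[of s1] s1 by simp
    qed (use 1 that in auto)
  qed
  have JB2: "(J s / (W s)\<^sup>2)\<^sup>2 \<le> B\<^sup>2" for s
  proof -
    have "\<bar>J s\<bar> \<le> B * (W s)\<^sup>2"
      using JB[of s] JB[of "- s"] Jmono[of 0 s] Jmono[of s 0]
      by (cases "0 \<le> s") (simp_all add: Jodd even J0)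
    then have "\<bar>J s / (W s)\<^sup>2\<bar> \<le> \<bar>B\<bar>" using pos[of s] B by (simp add: divide_le_eq abs_divide)
    then show ?thesis by (simp only: abs_le_square_iff)
  qed
  \<comment> \<open>With this \<open>e\<close> the quadratic error \<open>e^2 (J / W^2)^2\<close> is
    at most \<open>e / 2\<close>, so half of the gain \<open>e\<close> survives; \<open>c\<close>
    spends that half, because \<open>(c - 1) k \<le> (c - 1) * p 0 = e / 2\<close>.\<close>
  define e where "e = 1 / (2 * B\<^sup>2)"
  define c where "c = 1 + e / (2 * p 0)"
  have p0: "p 0 > 0" using p by (auto simp: nehari_function_def)
  have e: "e > 0" using B by (simp add: e_def)
  have c: "c > 1" using e p0 by (simp add: c_def)
  \<comment> \<open>\<open>W1 / W\<close> solves the Riccati equation for \<open>k\<close> exactly.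
    The quotient \<open>J / W^2\<close> solves the linearized equation with right-hand side 1, so
    subtracting \<open>e\<close> times it lowers the Riccati expression by \<open>e\<close> up to
    second order.\<close>
  define \<rho> where "\<rho> s = W1 s / W s - e * (J s / (W s)\<^sup>2)" for s
  define \<rho>' where "\<rho>' s = (1 - k s) - (W1 s / W s)\<^sup>2 - e * (1 - 2 * (W1 s / W s) * (J s / (W s)\<^sup>2))" for s
  have d\<rho>: "(\<rho> has_real_derivative \<rho>' s) (at s)" for s
    unfolding \<rho>_def \<rho>'_def using pos[of s]
    by (auto intro!: derivative_eq_intros W W1 J simp: field_simps power2_eq_square)
  have ric: "\<rho>' s + (\<rho> s)\<^sup>2 \<le> 1 - c * k s" for s
  proof -
    have 1: "\<rho>' s + (\<rho> s)\<^sup>2 = 1 - k s - e + e * e * (J s / (W s)\<^sup>2)\<^sup>2"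
      unfolding \<rho>_def \<rho>'_def by (simp add: algebra_simps power2_eq_square)
    have "e * e * (J s / (W s)\<^sup>2)\<^sup>2 \<le> e * e * B\<^sup>2" using JB2 e by (intro mult_left_mono) auto
    also have "\<dots> = e * (e * B\<^sup>2)" by (simp only: mult.assoc)
    also have "e * B\<^sup>2 = 1 / 2" using B by (simp add: e_def)
    finally have 2: "e * e * (J s / (W s)\<^sup>2)\<^sup>2 \<le> e / 2" by simp
    have "(c - 1) * k s \<le> (c - 1) * p 0" using k(4)[of s] c by (intro mult_left_mono) auto
    also have "\<dots> = e / 2" using p0 by (simp add: c_def)
    finally show ?thesis using 1 2 by (simp add: algebra_simps)
  qed
  have "nehari_function (\<lambda>x. c * p x)"
    unfolding nehari_function_def
  proof (intro conjI allI impI ballI)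
    show "continuous_on {-1<..<1} (\<lambda>x. c * p x)"
      using p by (auto simp: nehari_function_def intro!: continuous_intros)
    show "(1 - y\<^sup>2)\<^sup>2 * (c * p y) \<le> (1 - x\<^sup>2)\<^sup>2 * (c * p x)" if "0 \<le> x \<and> x \<le> y \<and> y < 1" for x y
    proof -
      have "(1 - y\<^sup>2)\<^sup>2 * p y \<le> (1 - x\<^sup>2)\<^sup>2 * p x" using p that unfolding nehari_function_def by blast
      from mult_left_mono[OF this, of c] c show ?thesis by (simp add: mult_ac)
    qed
    show "0 < c * p x" if "x \<in> {-1<..<1}" for x
      using p c that by (simp add: nehari_function_def)
    show "c * p (- x) = c * p x" if "x \<in> {-1<..<1}" for x
      using p that by (simp add: nehari_function_def)
    show "\<nexists>a b. - 1 < a \<and> a < b \<and> b < 1 \<and> u a = 0 \<and> u b = 0"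
      if u: "ode_solution (\<lambda>x. c * p x) u \<and> (\<exists>x\<in>{-1<..<1}. u x \<noteq> 0)" for u
    proof
      assume "\<exists>a b. - 1 < a \<and> a < b \<and> b < 1 \<and> u a = 0 \<and> u b = 0"
      then obtain a b where ab: "- 1 < a" "a < b" "b < 1" "u a = 0" "u b = 0" by blast
      from u obtain u' where u'': "\<forall>x\<in>{-1<..<1}. (u has_real_derivative u' x) (at x) \<and>
          (u' has_real_derivative (- (c * p x) * u x)) (at x)"
        unfolding ode_solution_def by blast
      have u': "\<And>x. \<bar>x\<bar> < 1 \<Longrightarrow> (u has_real_derivative u' x) (at x)"
        "\<And>x. \<bar>x\<bar> < 1 \<Longrightarrow> (u' has_real_derivative (- (c * p x) * u x)) (at x)"
        using u'' by (simp_all add: abs_less_iff)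
      note U = ode_to_hyperbolic[of u u' "\<lambda>x. c * p x", OF u']
      have k': "(1 - (tanh s)\<^sup>2)\<^sup>2 * (c * p (tanh s)) = c * k s" for s by (simp add: k_def)
      have r: "\<bar>1 - c * k s\<bar> \<le> 1 + c * p 0" for s
        using mult_left_mono[OF k(4)[of s], of c] mult_pos_pos[of c "k s"] k(1)[of s] c by linarith
      have at: "tanh (artanh x) = x" if "-1 < x" "x < 1" for x :: real
        using that by (intro tanh_artanh_real) auto
      have "cosh s * u (tanh s) = 0" for s
      proof (rule riccati_disconjugate[OF U(1) U(2)[unfolded k'] r d\<rho> ric, of "artanh a" "artanh b"])
        show "artanh a < artanh b"
          using ab at[of a] at[of b] by (subst tanh_real_less_iff[symmetric]) auto
      qed (use ab at in auto)
      then have "u x = 0" if "x \<in> {-1<..<1}" for x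
        using that at[of x] cosh_real_nonzero by (metis greaterThanLessThan_iff mult_eq_0_iff)
      then show False using u by blast
    qed
  qed
  then show False using ext c by (simp add: extremal_nehari_def)
qed

section \<open>Distortion along a curve\<close>

text \<open>The right-hand side is \<open>y'' / y\<close> for \<open>y = |X| / |\<psi>'|\<^sup>1\<^sup>/\<^sup>2\<close>, where \<open>X\<close> is the chord from a fixed
  point, \<open>D = \<psi>'\<close>, and \<open>2 b D + N = \<psi>''\<close>.\<close>
lemma chord_inequality:
  fixes X D N :: "'a::real_inner" and b b' r :: real
  assumes X: "X \<noteq> 0" and D: "D \<noteq> 0" and DN: "D \<bullet> N = 0"
    and h: "b' - b\<^sup>2 + (norm N)\<^sup>2 / (4 * (norm D)\<^sup>2) \<le> - r"
  defines "t \<equiv> (X \<bullet> D) / (X \<bullet> X)"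
  shows "r \<le> ((D \<bullet> D) + X \<bullet> (N + (2 * b) *\<^sub>R D)) / (X \<bullet> X) - t\<^sup>2 - 2 * t * b + b\<^sup>2 - b'"
proof -
  define M where "M = X \<bullet> X"
  define V where "V = D \<bullet> D"
  define s where "s = (X \<bullet> N) / M"
  define c where "c = N \<bullet> N"
  have M: "M > 0" and V: "V > 0" using X D by (auto simp: M_def V_def)
  have key: "- c / (4 * V) \<le> V / M - t\<^sup>2 + s"
  proof -
    \<comment> \<open>Completed square: \<open>Y\<close> is the component of \<open>X\<close>
      orthogonal to \<open>D\<close>, shifted by the multiple of \<open>N\<close> for which
      \<open>V / M^2\<close> times its squared length is exactly the difference of the two
      sides.\<close>
    define Y where "Y = X - (M * t / V) *\<^sub>R D + (M / (2 * V)) *\<^sub>R N"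
    have XD: "X \<bullet> D = M * t" using M by (simp add: t_def M_def)
    have XN: "X \<bullet> N = M * s" using M by (simp add: s_def)
    have "0 \<le> Y \<bullet> Y" by simp
    also have "Y \<bullet> Y = M - (M * t)\<^sup>2 / V + M * M * s / V + M\<^sup>2 * c / (4 * V\<^sup>2)"
      using V DN unfolding Y_def inner_simps
      by (simp add: XD XN inner_commute[of D X] inner_commute[of N X] inner_commute[of N D]
          V_def[symmetric] M_def[symmetric] c_def power2_norm_eq_inner field_simps power2_eq_square)
    finally have "0 \<le> (V / M\<^sup>2) * (M - (M * t)\<^sup>2 / V + M * M * s / V + M\<^sup>2 * c / (4 * V\<^sup>2))"
      using M V by simp
    also have "\<dots> = V / M - t\<^sup>2 + s + c / (4 * V)"
      using M V by (simp add: field_simps power2_eq_square)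
    finally show ?thesis by simp
  qed
  have "((D \<bullet> D) + X \<bullet> (N + (2 * b) *\<^sub>R D)) / (X \<bullet> X) = V / M + s + 2 * b * t"
    using M by (simp add: V_def[symmetric] M_def[symmetric] s_def inner_simps add_divide_distrib t_def)
  moreover have "(norm N)\<^sup>2 / (4 * (norm D)\<^sup>2) = c / (4 * V)" by (simp add: c_def V_def power2_norm_eq_inner)
  ultimately show ?thesis using key h by simp
qed

text \<open>\<open>2 * b\<close> is the logarithmic derivative of the speed, so the left side of
  \<open>curv\<close> is half of Ahlfors' Schwarzian of the curve: tangential part plus squared
  normal acceleration. The comparison is Sturm's, between \<open>y\<close> and
  \<open>W\<close>.\<close>

lemma curve_distortion:
  fixes \<psi> \<psi>1 \<psi>2 :: "real \<Rightarrow> 'a::real_inner" and b b1 W W1 r :: "real \<Rightarrow> real"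
  assumes \<psi>: "\<And>s. (\<psi> has_vector_derivative \<psi>1 s) (at s)"
    and \<psi>1: "\<And>s. (\<psi>1 has_vector_derivative \<psi>2 s) (at s)"
    and nz: "\<And>s. \<psi>1 s \<noteq> 0"
    and bdef: "\<And>s. \<psi>1 s \<bullet> \<psi>2 s = 2 * b s * (norm (\<psi>1 s))\<^sup>2"
    and b: "\<And>s. (b has_real_derivative b1 s) (at s)"
    and curv: "\<And>s. b1 s - (b s)\<^sup>2 + (norm (\<psi>2 s - (2 * b s) *\<^sub>R \<psi>1 s))\<^sup>2 / (4 * (norm (\<psi>1 s))\<^sup>2) \<le> - r s"
    and W: "\<And>s. (W has_real_derivative W1 s) (at s)"
    and W1: "\<And>s. (W1 has_real_derivative r s * W s) (at s)"
    and W01: "\<And>s. 0 < W s" "\<And>s. W s \<le> 1"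
    and ac: "a < c"
  shows "norm (\<psi> c - \<psi> a) \<ge> sqrt (norm (\<psi>1 a) * norm (\<psi>1 c)) * W a * W c * (c - a)"
proof -
  define X where "X s = \<psi> s - \<psi> a" for s
  define v where "v s = norm (\<psi>1 s)" for s
  define y where "y s = norm (X s) / sqrt (v s)" for s
  define t where "t s = (X s \<bullet> \<psi>1 s) / (X s \<bullet> X s)" for s
  define y1 where "y1 s = y s * (t s - b s)" for s
  define y2 where "y2 s = y s * (((\<psi>1 s \<bullet> \<psi>1 s) + X s \<bullet> \<psi>2 s) / (X s \<bullet> X s) - (t s)\<^sup>2 - 2 * t s * b s + (b s)\<^sup>2 - b1 s)" for s
  define Q where "Q s = W s * y1 s - W1 s * y s" for s
  have v: "v s > 0" for s using nz by (simp add: v_def)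
  have dX: "(X has_vector_derivative \<psi>1 s) (at s)" for s
    unfolding X_def by (auto intro!: derivative_eq_intros \<psi>)
  have dXX: "((\<lambda>s. X s \<bullet> X s) has_real_derivative 2 * (X s \<bullet> \<psi>1 s)) (at s)" for s
    using has_derivative_inner[OF dX[unfolded has_vector_derivative_def] dX[unfolded has_vector_derivative_def]]
    unfolding has_field_derivative_def
    by (rule has_derivative_eq_rhs) (auto simp: inner_commute algebra_simps)
  have dXP: "((\<lambda>s. X s \<bullet> \<psi>1 s) has_real_derivative (\<psi>1 s \<bullet> \<psi>1 s + X s \<bullet> \<psi>2 s)) (at s)" for s
    using has_derivative_inner[OF dX[unfolded has_vector_derivative_def] \<psi>1[unfolded has_vector_derivative_def]]
    unfolding has_field_derivative_def
    by (rule has_derivative_eq_rhs) (auto simp: inner_commute algebra_simps)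
  have dPP: "((\<lambda>s. \<psi>1 s \<bullet> \<psi>1 s) has_real_derivative 4 * b s * (v s)\<^sup>2) (at s)" for s
    using has_derivative_inner[OF \<psi>1[unfolded has_vector_derivative_def] \<psi>1[unfolded has_vector_derivative_def]]
    unfolding has_field_derivative_def
    by (rule has_derivative_eq_rhs) (auto simp: inner_commute[of "\<psi>2 s"] bdef v_def algebra_simps)
  have dsv: "((\<lambda>s. sqrt (v s)) has_real_derivative b s * sqrt (v s)) (at s)" for s
  proof -
    have "((\<lambda>s. sqrt (\<psi>1 s \<bullet> \<psi>1 s)) has_real_derivative 2 * b s * v s) (at s)"
      using nz[of s] v[of s]
      by (intro DERIV_real_sqrt[THEN DERIV_chain2, THEN DERIV_cong, OF _ dPP];
        simp add: norm_eq_sqrt_inner[symmetric] v_def[symmetric] field_simps power2_eq_square)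
    then have dv: "(v has_real_derivative 2 * b s * v s) (at s)"
      by (simp add: v_def[abs_def] norm_eq_sqrt_inner)
    show ?thesis using v[of s]
      by (auto intro!: derivative_eq_intros dv simp: field_simps)
  qed
  have dy: "(y has_real_derivative y1 s) (at s)" if "X s \<noteq> 0" for s
  proof -
    have dn: "((\<lambda>s. norm (X s)) has_real_derivative t s * norm (X s)) (at s)"
    proof -
      have "((\<lambda>s. sqrt (X s \<bullet> X s)) has_real_derivative t s * norm (X s)) (at s)"
        using that by (intro DERIV_real_sqrt[THEN DERIV_chain2, THEN DERIV_cong, OF _ dXX];
          simp add: norm_eq_sqrt_inner[symmetric] t_def power2_norm_eq_inner[symmetric] field_simps power2_eq_square)
      then show ?thesis by (simp add: norm_eq_sqrt_inner)
    qed
    have alg: "(t * n * w - n * (b * w)) / (w * w) = n / w * (t - b)" if "w \<noteq> 0" for t n w b :: real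
      using that by (simp add: field_simps)
    show ?thesis unfolding y_def y1_def using v[of s]
      by (intro DERIV_divide[OF dn dsv, THEN DERIV_cong] alg) simp_all
  qed
  have dt: "(t has_real_derivative ((\<psi>1 s \<bullet> \<psi>1 s) + X s \<bullet> \<psi>2 s) / (X s \<bullet> X s) - 2 * (t s)\<^sup>2) (at s)" if "X s \<noteq> 0" for s
    unfolding t_def using that
    by (auto intro!: derivative_eq_intros dXX dXP simp: field_simps power2_eq_square)
  have dy1: "(y1 has_real_derivative y2 s) (at s)" if "X s \<noteq> 0" for s
    unfolding y1_def[abs_def] y2_def
    by (rule derivative_eq_intros dy dt b that refl)+ (simp add: y1_def algebra_simps power2_eq_square)
  have y2: "r s * y s \<le> y2 s" if "X s \<noteq> 0" for s
  proof -
    have "r s \<le> ((\<psi>1 s \<bullet> \<psi>1 s) + X s \<bullet> ((\<psi>2 s - (2 * b s) *\<^sub>R \<psi>1 s) + (2 * b s) *\<^sub>R \<psi>1 s)) / (X s \<bullet> X s) - (t s)\<^sup>2 - 2 * t s * b s + (b s)\<^sup>2 - b1 s"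
      unfolding t_def
      by (rule chord_inequality[OF that nz _ curv]) (simp add: inner_simps bdef power2_norm_eq_inner)
    from mult_left_mono[OF this, of "y s"] show ?thesis
      using v[of s] by (simp add: y2_def y_def mult.commute)
  qed
  have dQ: "(Q has_real_derivative W s * (y2 s - r s * y s)) (at s)" if "X s \<noteq> 0" for s
    unfolding Q_def
    by (rule derivative_eq_intros dy dy1 W W1 that refl)+ (simp add: algebra_simps)
  have Xa: "X a = 0" by (simp add: X_def)
  \<comment> \<open>The norm of the chord is not differentiable where the chord vanishes, so the
    initial value of \<open>Q\<close> has to be found as a one-sided limit, from the direction of
    the rescaled chord.\<close>
  have quot: "((\<lambda>s. (1 / (s - a)) *\<^sub>R X s) \<longlongrightarrow> \<psi>1 a) (at_right a)"
  proof -
    have "((\<lambda>s. (X s - X a - (s - a) *\<^sub>R \<psi>1 a) /\<^sub>R norm (s - a)) \<longlongrightarrow> 0) (at_right a)"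
      using has_vector_derivative_at_within[OF dX[of a], of "{a<..}"]
      by (simp add: has_vector_derivative_def has_derivative_at_within)
    then have "((\<lambda>s. (X s - X a - (s - a) *\<^sub>R \<psi>1 a) /\<^sub>R norm (s - a) + \<psi>1 a) \<longlongrightarrow> 0 + \<psi>1 a) (at_right a)"
      by (intro tendsto_intros)
    then show ?thesis
    proof (rule Lim_transform_eventually[THEN tendsto_eq_rhs])
      show "\<forall>\<^sub>F s in at_right a. (X s - X a - (s - a) *\<^sub>R \<psi>1 a) /\<^sub>R norm (s - a) + \<psi>1 a = (1 / (s - a)) *\<^sub>R X s"
        using eventually_at_right_less[of a]
        by eventually_elim (simp add: Xa scaleR_diff_right inverse_eq_divide)
    qed simp
  qed
  have near: "eventually (\<lambda>s. X s \<noteq> 0) (at_right a)"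
    using tendsto_imp_eventually_ne[OF quot nz] by (auto elim!: eventually_mono)
  have contX: "isCont X s" and cont1: "isCont \<psi>1 s" and contW: "isCont W s" and contW1: "isCont W1 s"
    and contb: "isCont b s" for s
    by (rule has_vector_derivative_continuous[OF dX] has_vector_derivative_continuous[OF \<psi>1]
        DERIV_isCont[OF W] DERIV_isCont[OF W1] DERIV_isCont[OF b])+
  have conty: "isCont y s" for s
    unfolding y_def v_def using nz by (intro continuous_intros contX cont1) auto
  have Qlim: "(Q \<longlongrightarrow> W a * sqrt (v a)) (at_right a)"
  proof -
    have lim: "(f \<longlongrightarrow> f a) (at_right a)" if "isCont f a" for f :: "real \<Rightarrow> 'b::real_normed_vector"
      using that by (auto simp: isCont_def intro: tendsto_mono[OF at_le])
    have ya: "y a = 0" by (simp add: y_def Xa)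
    \<comment> \<open>The product \<open>y t\<close> depends on the chord only through its
      direction, so the chord may be replaced by \<open>q\<close>, which has a nonzero
      limit.\<close>
    define q where "q s = (1 / (s - a)) *\<^sub>R X s" for s
    have "((\<lambda>s. W s * ((q s \<bullet> \<psi>1 s) / (norm (q s) * sqrt (v s)) - y s * b s) - W1 s * y s) \<longlongrightarrow>
        W a * ((\<psi>1 a \<bullet> \<psi>1 a) / (norm (\<psi>1 a) * sqrt (v a)) - y a * b a) - W1 a * y a) (at_right a)"
      unfolding v_def q_def using nz
      by (intro tendsto_intros quot lim contW contW1 contb cont1 conty) auto
    also have "W a * ((\<psi>1 a \<bullet> \<psi>1 a) / (norm (\<psi>1 a) * sqrt (v a)) - y a * b a) - W1 a * y a = W a * sqrt (v a)"
      using v[of a] by (simp add: ya v_def power2_norm_eq_inner[symmetric] field_simps power2_eq_square)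
    finally show ?thesis
    proof (rule Lim_transform_eventually)
      show "\<forall>\<^sub>F s in at_right a. W s * ((q s \<bullet> \<psi>1 s) / (norm (q s) * sqrt (v s)) - y s * b s) - W1 s * y s = Q s"
        using near eventually_at_right_less[of a]
      proof eventually_elim
        case (elim s)
        have "(q s \<bullet> \<psi>1 s) / (norm (q s) * sqrt (v s)) = y s * t s"
          using elim v[of s] by (simp add: q_def y_def t_def power2_norm_eq_inner[symmetric] field_simps power2_eq_square)
        then show ?case by (simp add: Q_def y1_def algebra_simps)
      qed
    qed
  qed
  have main: "W a * sqrt (v a) * (s - a) \<le> y s / W s"
    if "a < s" and nzs: "\<And>\<sigma>. a < \<sigma> \<Longrightarrow> \<sigma> < s \<Longrightarrow> X \<sigma> \<noteq> 0" for s
  proof -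
    have Qge: "W a * sqrt (v a) \<le> Q \<sigma>" if \<sigma>: "a < \<sigma>" "\<sigma> < s" for \<sigma>
    proof (rule tendsto_upperbound[OF Qlim])
      show "\<forall>\<^sub>F \<tau> in at_right a. Q \<tau> \<le> Q \<sigma>"
        unfolding eventually_at_right_field
      proof (intro exI[of _ \<sigma>] conjI allI impI \<sigma>(1))
        fix \<tau> assume \<tau>: "a < \<tau>" "\<tau> < \<sigma>"
        show "Q \<tau> \<le> Q \<sigma>"
        proof (rule DERIV_nonneg_imp_nondecreasing[where f=Q], goal_cases)
          case (2 x)
          then have "X x \<noteq> 0" using \<tau> \<sigma> by (intro nzs) auto
          from dQ[OF this] y2[OF this] W01(1)[of x] show ?case by force
        qed (use \<tau> in auto)
      qed
    qed simp
    have "y a / W a - W a * sqrt (v a) * a \<le> y s / W s - W a * sqrt (v a) * s"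
    proof (rule DERIV_nonneg_imp_increasing_open[where f="\<lambda>s. y s / W s - W a * sqrt (v a) * s"], goal_cases)
      case (2 x)
      have "((\<lambda>s. y s / W s - W a * sqrt (v a) * s) has_real_derivative
          Q x / (W x)\<^sup>2 - W a * sqrt (v a)) (at x)"
        using W01(1)[of x] nzs[of x] 2
        by (auto intro!: derivative_eq_intros dy W simp: Q_def field_simps power2_eq_square)
      \<comment> \<open>Here \<open>W \<le> 1\<close> turns the lower bound on \<open>Q\<close> into
        one on the derivative of \<open>y / W\<close>, with a constant free of
        \<open>x\<close>.\<close>
      moreover have "W a * sqrt (v a) \<le> Q x / (W x)\<^sup>2"
      proof -
        have "(W x)\<^sup>2 \<le> 1" using W01[of x] by (simp add: power_le_one)
        then have "W a * sqrt (v a) * (W x)\<^sup>2 \<le> W a * sqrt (v a)"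
          using W01(1)[of a] v[of a] by (simp add: mult_le_cancel_left1)
        then show ?thesis using Qge[of x] 2 W01(1)[of x] by (simp add: pos_le_divide_eq)
      qed
      ultimately show ?case by force
    next
      case 3
      show ?case using W01(1)
        by (intro continuous_at_imp_continuous_on ballI continuous_intros conty contW) (simp add: less_imp_neq[symmetric])
    qed (use that in auto)
    then show ?thesis by (simp add: y_def Xa algebra_simps)
  qed
  have nzX: "X s \<noteq> 0" if s: "a < s" for s
  proof
    assume "X s = 0"
    from near obtain d where d: "a < d" "\<And>\<sigma>. a < \<sigma> \<Longrightarrow> \<sigma> < d \<Longrightarrow> X \<sigma> \<noteq> 0"
      by (auto simp: eventually_at_right_field)
    \<comment> \<open>Starting at \<open>d\<close>, past the zero at the base point, makes the zero
      set compact. At its least element \<open>z\<close> the estimate \<open>main\<close> still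
      applies, since it requires nonvanishing only strictly before the endpoint, and contradicts
      \<open>y z = 0\<close>.\<close>
    define Z where "Z = {d..s} \<inter> X -` {0}"
    have "s \<in> Z" using d(2)[of s] s \<open>X s = 0\<close> by (force simp: Z_def)
    moreover have "compact Z"
      unfolding Z_def using contX
      by (intro closed_Int_compact compact_Int_closed continuous_closed_vimage) auto
    ultimately obtain z where z: "z \<in> Z" "\<And>w. w \<in> Z \<Longrightarrow> z \<le> w"
      using compact_attains_inf[of Z] by blast
    have "X \<sigma> \<noteq> 0" if "a < \<sigma>" "\<sigma> < z" for \<sigma>
    proof (cases "\<sigma> < d")
      case False
      show ?thesis
      proof
        assume "X \<sigma> = 0"
        then have "\<sigma> \<in> Z" using False z(1) that by (auto simp: Z_def)
        then show False using z(2)[of \<sigma>] that by simp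
      qed
    qed (use that d in auto)
    then have "W a * sqrt (v a) * (z - a) \<le> y z / W z"
      using z d by (intro main) (auto simp: Z_def)
    moreover have "W a * sqrt (v a) * (z - a) > 0"
      using z d W01(1)[of a] v[of a] by (auto simp: Z_def)
    ultimately show False using z by (simp add: y_def Z_def)
  qed
  from main[OF ac nzX] have "W a * sqrt (v a) * (c - a) * W c \<le> y c"
    using W01(1)[of c] by (simp add: pos_le_divide_eq)
  then have "W a * sqrt (v a) * (c - a) * W c * sqrt (v c) \<le> norm (X c)"
    using v[of c] by (simp add: y_def pos_le_divide_eq)
  then show ?thesis by (simp add: X_def v_def real_sqrt_mult mult_ac)
qed

section \<open>Hyperbolic geodesics\<close>

text \<open>The geodesic of the disk that is closest to the origin at \<open>\<i> \<omega> r\<close>, parametrized by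
  hyperbolic arc length.\<close>
definition geodesic :: "complex \<Rightarrow> real \<Rightarrow> real \<Rightarrow> complex" where
  "geodesic \<omega> r s = \<omega> * (of_real (tanh s) + \<i> * r) / (1 - \<i> * r * of_real (tanh s))"

definition geodesic_deriv :: "complex \<Rightarrow> real \<Rightarrow> real \<Rightarrow> complex" where
  "geodesic_deriv \<omega> r s = \<omega> * (1 - r\<^sup>2) * (1 - (of_real (tanh s))\<^sup>2) / (1 - \<i> * r * of_real (tanh s))\<^sup>2"

text \<open>The quotient of the second by the first derivative of the geodesic; the rotation
  \<open>\<omega>\<close> cancels in it.\<close>

definition geodesic_preschwarz :: "real \<Rightarrow> real \<Rightarrow> complex" where
  "geodesic_preschwarz r s = - 2 * (of_real (tanh s) - \<i> * r) / (1 - \<i> * r * of_real (tanh s))"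

lemma one_minus_i_real_nz: "1 - \<i> * complex_of_real a * complex_of_real b \<noteq> 0"
  by (simp add: complex_eq_iff)

lemma tanh_of_real_has_vector_derivative:
  "((\<lambda>s. complex_of_real (tanh s)) has_vector_derivative (1 - (complex_of_real (tanh s))\<^sup>2)) (at s)"
proof -
  have "(tanh has_real_derivative 1 - (tanh s)\<^sup>2) (at s)"
    by (auto intro!: derivative_eq_intros)
  from has_vector_derivative_of_real[OF this] show ?thesis by simp
qed

text \<open>The third clause says that the Schwarzian \<open>c' - c^2 / 2\<close> equals
  \<open>-2\<close>: a geodesic is a Moebius image of \<open>tanh\<close>, and Moebius maps leave
  the Schwarzian unchanged.\<close>

lemma geodesic_has_vector_derivative:
  "(geodesic \<omega> r has_vector_derivative geodesic_deriv \<omega> r s) (at s)"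
  "(geodesic_deriv \<omega> r has_vector_derivative geodesic_preschwarz r s * geodesic_deriv \<omega> r s) (at s)"
  "(geodesic_preschwarz r has_vector_derivative (geodesic_preschwarz r s)\<^sup>2 / 2 - 2) (at s)"
proof -
  define x where "x = complex_of_real (tanh s)"
  have D: "((\<lambda>s. F (complex_of_real (tanh s))) has_vector_derivative d * (1 - x\<^sup>2)) (at s)"
    if "(F has_field_derivative d) (at x)" for F d
    using field_vector_diff_chain_at[OF tanh_of_real_has_vector_derivative that[unfolded x_def]]
    by (simp add: o_def x_def mult.commute)
  have nz: "1 - \<i> * r * x \<noteq> 0" unfolding x_def by (rule one_minus_i_real_nz)
  show "(geodesic \<omega> r has_vector_derivative geodesic_deriv \<omega> r s) (at s)"
  proof -
    have "((\<lambda>x. \<omega> * (x + \<i> * r) / (1 - \<i> * r * x)) has_field_derivative \<omega> * (1 - r\<^sup>2) / (1 - \<i> * r * x)\<^sup>2) (at x)"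
      using nz by (auto intro!: derivative_eq_intros simp: field_simps power2_eq_square)
    from D[OF this] show ?thesis by (simp add: geodesic_def[abs_def] geodesic_deriv_def x_def)
  qed
  show "(geodesic_deriv \<omega> r has_vector_derivative geodesic_preschwarz r s * geodesic_deriv \<omega> r s) (at s)"
  proof -
    have "((\<lambda>x. \<omega> * (1 - r\<^sup>2) * (1 - x\<^sup>2) / (1 - \<i> * r * x)\<^sup>2) has_field_derivative
        (- 2 * (x - \<i> * r) / (1 - \<i> * r * x)) * (\<omega> * (1 - r\<^sup>2) / (1 - \<i> * r * x)\<^sup>2)) (at x)"
      using nz
      apply (auto intro!: derivative_eq_intros)
      apply (simp add: divide_simps)
      apply (simp add: algebra_simps power2_eq_square power4_eq_xxxx)
      done
    from D[OF this] show ?thesis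
      by (simp add: geodesic_deriv_def[abs_def] geodesic_preschwarz_def x_def mult.assoc)
  qed
  show "(geodesic_preschwarz r has_vector_derivative (geodesic_preschwarz r s)\<^sup>2 / 2 - 2) (at s)"
  proof -
    have d: "((\<lambda>x. - 2 * (x - \<i> * r) / (1 - \<i> * r * x)) has_field_derivative
        - 2 * (1 + r\<^sup>2) / (1 - \<i> * r * x)\<^sup>2) (at x)"
      using nz by (auto intro!: derivative_eq_intros simp: field_simps power2_eq_square)
    have eq: "- 2 * (1 + r\<^sup>2) / (1 - \<i> * r * x)\<^sup>2 * (1 - x\<^sup>2) =
        (- 2 * (x - \<i> * r) / (1 - \<i> * r * x))\<^sup>2 / 2 - 2"
      using nz by (simp add: divide_simps) (simp add: algebra_simps power2_eq_square)
    from D[OF d, unfolded eq] show ?thesis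
      by (simp only: geodesic_preschwarz_def[abs_def] x_def)
  qed
qed

text \<open>All three follow from \<open>1 - \<bar>\<gamma>\<bar>^2 = (1 - r^2) (1 - x^2) / (1 + r^2
  x^2)\<close> with \<open>x = tanh s\<close>. The last clause is unit hyperbolic speed; the first
  lets the monotone weight be compared at \<open>tanh s\<close>.\<close>

lemma geodesic_norm:
  assumes "cmod \<omega> = 1" "\<bar>r\<bar> < 1"
  shows "\<bar>tanh s\<bar> \<le> cmod (geodesic \<omega> r s)" "cmod (geodesic \<omega> r s) < 1"
    "cmod (geodesic_deriv \<omega> r s) = 1 - (cmod (geodesic \<omega> r s))\<^sup>2"
proof -
  define x where "x = tanh s"
  have x: "x\<^sup>2 < 1" using tanh_real_gt_neg1[of s] tanh_real_lt_1[of s] by (simp add: x_def abs_square_less_1)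
  have r: "r\<^sup>2 < 1" using assms by (simp add: abs_square_less_1)
  have den: "(cmod (1 - \<i> * r * x))\<^sup>2 = 1 + r\<^sup>2 * x\<^sup>2" "1 + r\<^sup>2 * x\<^sup>2 > 0"
    by (auto simp: cmod_power2 power_mult_distrib intro: add_pos_nonneg)
  have n2: "(cmod (geodesic \<omega> r s))\<^sup>2 = (x\<^sup>2 + r\<^sup>2) / (1 + r\<^sup>2 * x\<^sup>2)"
    using assms den by (simp add: geodesic_def norm_divide norm_mult power_divide x_def[symmetric] cmod_power2)
  have "x\<^sup>2 * (1 + r\<^sup>2 * x\<^sup>2) \<le> x\<^sup>2 + r\<^sup>2"
  proof -
    have "r\<^sup>2 * (x\<^sup>2 * x\<^sup>2) \<le> r\<^sup>2 * (1 * 1)" using x by (intro mult_left_mono mult_mono) auto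
    then show ?thesis by (simp add: algebra_simps)
  qed
  then have "\<bar>x\<bar>\<^sup>2 \<le> (cmod (geodesic \<omega> r s))\<^sup>2" using den by (simp add: n2 pos_le_divide_eq)
  then show "\<bar>tanh s\<bar> \<le> cmod (geodesic \<omega> r s)" unfolding x_def by (rule power2_le_imp_le) simp
  have e: "1 - (cmod (geodesic \<omega> r s))\<^sup>2 = (1 - r\<^sup>2) * (1 - x\<^sup>2) / (1 + r\<^sup>2 * x\<^sup>2)"
    using den(2) unfolding n2 by (simp add: field_simps)
  moreover have "\<dots> > 0" using den x r by simp
  ultimately have "(cmod (geodesic \<omega> r s))\<^sup>2 < 1" by linarith
  then show "cmod (geodesic \<omega> r s) < 1" by (simp add: abs_square_less_1)
  have c: "cmod (1 - (complex_of_real y)\<^sup>2) = 1 - y\<^sup>2" if "y\<^sup>2 < 1" for y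
  proof -
    have "1 - (complex_of_real y)\<^sup>2 = of_real (1 - y\<^sup>2)" by simp
    then show ?thesis using that by (simp only: norm_of_real)
  qed
  show "cmod (geodesic_deriv \<omega> r s) = 1 - (cmod (geodesic \<omega> r s))\<^sup>2"
    unfolding e geodesic_deriv_def x_def[symmetric]
    using assms c[OF x] c[OF r] by (simp add: norm_divide norm_mult norm_power den)
qed

text \<open>The map \<open>y \<mapsto> e (y + \<alpha>) / (1 + cnj \<alpha> * y)\<close> sends the
  real diameter to the geodesic, with \<open>z1\<close> at \<open>y = 0\<close> and
  \<open>z2\<close> at \<open>y = \<delta>\<close>. Substituting
  \<open>y = (x + t) / (1 + t x)\<close> moves the point nearest the origin to \<open>x = 0\<close>,
  as the normal form demands.\<close>

lemma geodesic_through: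
  assumes z1: "cmod z1 < 1" and z2: "cmod z2 < 1" and ne: "z1 \<noteq> z2"
  obtains \<omega> r a b where "cmod \<omega> = 1" "\<bar>r\<bar> < 1" "a < b" "geodesic \<omega> r a = z1" "geodesic \<omega> r b = z2"
    "hyp_dist z1 z2 = b - a"
proof -
  define w where "w = 1 - cnj z1 * z2"
  have "cmod (cnj z1 * z2) < 1" using mult_strict_mono'[OF z1 z2] by (simp add: norm_mult)
  then have w: "w \<noteq> 0" by (auto simp: w_def)
  define \<delta> where "\<delta> = cmod ((z2 - z1) / w)"
  have \<delta>0: "\<delta> > 0" using ne w by (simp add: \<delta>_def)
  have mob: "cmod (u + v) < cmod (1 + cnj u * v)" if "cmod u < 1" "cmod v < 1" for u v
  proof -
    have "0 < (1 - (cmod u)\<^sup>2) * (1 - (cmod v)\<^sup>2)" using that by (simp add: abs_square_less_1)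
    also have "\<dots> = (cmod (1 + cnj u * v))\<^sup>2 - (cmod (u + v))\<^sup>2"
      unfolding cmod_power2 by (simp add: algebra_simps power2_eq_square)
    finally show ?thesis by (simp add: power_less_imp_less_base)
  qed
  have \<delta>1: "\<delta> < 1"
    using mob[of "- z1" z2] z1 z2 w by (simp add: \<delta>_def w_def norm_divide)
  define e where "e = (z2 - z1) / w / \<delta>"
  have e: "cmod e = 1" unfolding e_def norm_divide[of _ "complex_of_real \<delta>"] using \<delta>0 by (simp add: \<delta>_def[symmetric])
  have ee: "cnj e * e = 1" using e by (metis complex_norm_square mult.commute of_real_1 power_one)
  have ed: "e * \<delta> * w = z2 - z1" using w \<delta>0 by (simp add: e_def)
  define \<alpha> where "\<alpha> = z1 * cnj e"
  have \<alpha>: "cmod \<alpha> < 1" using z1 e by (simp add: \<alpha>_def norm_mult)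
  have \<alpha>e: "\<alpha> * e = z1" using ee by (simp add: \<alpha>_def mult.assoc)
  \<comment> \<open>The equation says that \<open>(\<alpha> + t) / (1 + \<alpha> t)\<close> is
    purely imaginary. At \<open>t = 1\<close> its left side is
    \<open>(cmod (1 + \<alpha>))^2\<close>, at \<open>t = -1\<close> it is
    \<open>-(cmod (1 - \<alpha>))^2\<close>, whence the sign change.\<close>
  have "\<exists>t\<ge>-1. t \<le> 1 \<and> Re \<alpha> * (1 + t\<^sup>2) + (1 + (cmod \<alpha>)\<^sup>2) * t = 0"
  proof (rule IVT')
    have "0 \<le> (cmod (1 + \<alpha>))\<^sup>2" "0 \<le> (cmod (1 - \<alpha>))\<^sup>2" by simp_all
    then show "Re \<alpha> * (1 + (- 1)\<^sup>2) + (1 + (cmod \<alpha>)\<^sup>2) * - 1 \<le> 0"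
      "0 \<le> Re \<alpha> * (1 + 1\<^sup>2) + (1 + (cmod \<alpha>)\<^sup>2) * 1"
      unfolding cmod_power2 by (simp_all add: algebra_simps power2_eq_square)
  qed (auto intro!: continuous_intros)
  then obtain t where t: "-1 \<le> t" "t \<le> 1" "Re \<alpha> * (1 + t\<^sup>2) + (1 + (cmod \<alpha>)\<^sup>2) * t = 0" by blast
  have "cmod (1 + \<alpha>) > 0" "cmod (1 - \<alpha>) > 0"
    using \<alpha> by (auto simp: add_eq_0_iff)
  then have "(cmod (1 + \<alpha>))\<^sup>2 > 0" "(cmod (1 - \<alpha>))\<^sup>2 > 0" by simp_all
  then have "t \<noteq> 1" "t \<noteq> -1"
    using t(3) unfolding cmod_power2 by (auto simp: algebra_simps power2_eq_square)
  with t have t1: "-1 < t" "t < 1" by auto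
  define q where "q = 1 + \<alpha> * t"
  have qm: "cmod (\<alpha> + t) < cmod q"
    using mob[of "complex_of_real t" \<alpha>] \<alpha> t1 by (simp add: q_def add.commute mult.commute abs_less_iff)
  then have q: "q \<noteq> 0" by auto
  define \<beta> where "\<beta> = (\<alpha> + t) / q"
  have "Re ((\<alpha> + t) * cnj q) = 0"
    using t(3) unfolding q_def cmod_power2 by (simp add: algebra_simps power2_eq_square)
  moreover have "(\<alpha> + t) * cnj q = \<beta> * of_real ((cmod q)\<^sup>2)"
    using q unfolding complex_norm_square by (simp add: \<beta>_def)
  ultimately have "Re (\<beta> * of_real ((cmod q)\<^sup>2)) = 0" by (simp only:)
  then have "Re \<beta> * (cmod q)\<^sup>2 = 0"
    by (simp only: times_complex.simps Re_complex_of_real Im_complex_of_real mult_zero_right diff_zero)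
  then have "Re \<beta> = 0" using q by simp
  define r where "r = Im \<beta>"
  have \<beta>: "\<beta> = \<i> * r" using \<open>Re \<beta> = 0\<close> by (simp add: complex_eq_iff r_def)
  have "cmod \<beta> < 1" using qm q by (simp add: \<beta>_def norm_divide pos_divide_less_eq)
  then have r: "\<bar>r\<bar> < 1" by (simp add: \<beta> norm_mult)
  define \<omega> where "\<omega> = e * q / cnj q"
  have \<omega>: "cmod \<omega> = 1" using e q by (simp add: \<omega>_def norm_mult norm_divide)
  define A where "A x = (x + t) + \<alpha> * (1 + t * x)" for x :: real
  define B where "B x = (1 + t * x) + cnj \<alpha> * (x + t)" for x :: real
  have val: "\<omega> * (x + \<i> * r) / (1 - \<i> * r * x) = e * A x / B x" for x :: real
  proof -
    have \<beta>q: "\<beta> * q = \<alpha> + t" "cnj \<beta> * cnj q = cnj \<alpha> + t" using q by (simp_all add: \<beta>_def)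
    have "(x + \<beta>) * q = x * q + \<beta> * q" by (rule distrib_right)
    also have "\<dots> = A x" unfolding \<beta>q by (simp add: A_def q_def algebra_simps)
    finally have n: "x + \<i> * r = A x / q" using q unfolding \<beta> by (simp only: eq_divide_eq) simp
    have "(1 + cnj \<beta> * x) * cnj q = cnj q + (cnj \<beta> * cnj q) * x" by (simp only: algebra_simps mult_1)
    also have "\<dots> = B x" unfolding \<beta>q by (simp add: B_def q_def algebra_simps)
    finally have "1 + cnj \<beta> * x = B x / cnj q" using q by (simp only: eq_divide_eq) simp
    moreover have "1 - \<i> * r * x = 1 + cnj \<beta> * x" by (simp add: \<beta>)
    ultimately have d: "1 - \<i> * r * x = B x / cnj q" by (rule trans[rotated])
    show ?thesis unfolding n d using q by (simp add: \<omega>_def)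
  qed
  \<comment> \<open>In the variable \<open>x\<close> the points sit where
    \<open>(x + t) / (1 + t x)\<close> equals 0 and \<open>\<delta>\<close>; the addition theorem
    then gives \<open>tanh (b - a) = \<delta>\<close>.\<close>
  define a where "a = - artanh t"
  define x where "x = (\<delta> - t) / (1 - t * \<delta>)"
  define b where "b = artanh x"
  have td: "1 - t * \<delta> > 0"
    using mult_strict_right_mono[OF t1(2) \<delta>0] \<delta>1 by simp
  have x1: "\<bar>x\<bar> < 1"
  proof -
    have "0 < (1 - \<delta>) * (1 + t)" "0 < (1 + \<delta>) * (1 - t)" using t1 \<delta>0 \<delta>1 by simp_all
    then show ?thesis using td by (simp add: x_def abs_less_iff divide_less_eq minus_divide_left algebra_simps)
  qed
  have tt: "tanh (artanh t) = t" using t1 by (intro tanh_artanh_real) auto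
  have ta: "tanh a = - t" by (simp add: a_def tt)
  have tb: "tanh b = x" using x1 by (simp add: b_def tanh_artanh_real)
  have t2: "1 - t * t > 0" using t1 abs_square_less_1[of t] by (simp add: power2_eq_square abs_less_iff)
  have xt: "x + t = \<delta> * ((1 - t * t) / (1 - t * \<delta>))" "1 + t * x = (1 - t * t) / (1 - t * \<delta>)"
    using td by (simp_all add: x_def field_simps)
  have ba: "tanh (b - a) = \<delta>"
  proof -
    have "tanh (b - a) = (x + t) / (1 + t * x)"
      using tanh_add[of b "artanh t"] by (simp add: a_def tt tb mult.commute)
    then show ?thesis unfolding xt using t2 td by simp
  qed
  have "geodesic \<omega> r a = z1"
  proof -
    have "A (- t) = \<alpha> * of_real (1 - t * t)" "B (- t) = of_real (1 - t * t)" by (simp_all add: A_def B_def)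
    moreover have "complex_of_real (1 - t * t) \<noteq> 0" using t2 by (simp only: of_real_eq_0_iff)
    ultimately show ?thesis
      using val[of "- t"] \<alpha>e by (simp add: geodesic_def ta mult.commute)
  qed
  moreover have "geodesic \<omega> r b = z2"
  proof -
    define k where "k = complex_of_real ((1 - t * t) / (1 - t * \<delta>))"
    have k: "k \<noteq> 0" using t2 td by (simp add: k_def del: of_real_divide of_real_diff of_real_mult)
    have "complex_of_real (x + t) = \<delta> * k" "complex_of_real (1 + t * x) = k"
      unfolding xt k_def by simp_all
    then have "A x = k * (\<delta> + \<alpha>)" "B x = k * (1 + cnj \<alpha> * \<delta>)"
      by (simp_all add: A_def B_def algebra_simps)
    then have "geodesic \<omega> r b = e * (\<delta> + \<alpha>) / (1 + cnj \<alpha> * \<delta>)"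
      using val[of x] k by (simp add: geodesic_def tb)
    also have "e * (\<delta> + \<alpha>) = z2 * (1 + cnj z1 * (e * \<delta>))"
      using ed \<alpha>e by (simp add: w_def algebra_simps)
    also have "cnj z1 * (e * \<delta>) = cnj \<alpha> * \<delta>" by (simp add: \<alpha>_def)
    also have "z2 * (1 + cnj \<alpha> * \<delta>) / (1 + cnj \<alpha> * \<delta>) = z2"
    proof -
      have "cmod (cnj \<alpha> * \<delta>) < 1" using mult_strict_mono'[OF \<alpha> \<delta>1] \<delta>0 by (simp add: norm_mult)
      then have "1 + cnj \<alpha> * \<delta> \<noteq> 0" by (auto simp: add_eq_0_iff)
      then show ?thesis by simp
    qed
    finally show ?thesis .
  qed
  moreover have "a < b"
    using ba \<delta>0 by (metis diff_gt_0_iff_gt tanh_real_pos_iff)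
  moreover have "hyp_dist z1 z2 = b - a"
  proof -
    have "hyp_dist z1 z2 = artanh \<delta>"
      by (simp add: hyp_dist_def Let_def \<delta>_def w_def artanh_def norm_divide norm_minus_commute)
    then show ?thesis using ba artanh_tanh_real[of "b - a"] by simp
  qed
  ultimately show thesis using that \<omega> r by blast
qed

section \<open>The lifted minimal surface\<close>

lemma px_eq:
  assumes "(u has_derivative D) (at z)" shows "px u z = D 1"
proof -
  have "((\<lambda>t::real. z + complex_of_real t) has_derivative complex_of_real) (at 0)"
    by (auto intro!: derivative_eq_intros)
  from diff_chain_at[OF this, of u D] assms
  have "((\<lambda>t::real. u (z + complex_of_real t)) has_derivative (\<lambda>t. D (complex_of_real t))) (at 0)"
    by (simp add: o_def)
  then have "((\<lambda>t::real. u (z + complex_of_real t)) has_vector_derivative D 1) (at 0)"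
    unfolding has_vector_derivative_def
    using linear_cmul[OF has_derivative_linear[OF assms], of _ 1] by (simp add: scaleR_conv_of_real)
  then show ?thesis unfolding px_def by (rule vector_derivative_at)
qed

lemma py_eq:
  assumes "(u has_derivative D) (at z)" shows "py u z = D \<i>"
proof -
  have "((\<lambda>t::real. z + \<i> * complex_of_real t) has_derivative (\<lambda>t. \<i> * complex_of_real t)) (at 0)"
    by (auto intro!: derivative_eq_intros)
  from diff_chain_at[OF this, of u D] assms
  have "((\<lambda>t::real. u (z + \<i> * complex_of_real t)) has_derivative (\<lambda>t. D (\<i> * complex_of_real t))) (at 0)"
    by (simp add: o_def)
  then have "((\<lambda>t::real. u (z + \<i> * complex_of_real t)) has_vector_derivative D \<i>) (at 0)"
    unfolding has_vector_derivative_def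
    using linear_cmul[OF has_derivative_linear[OF assms], of _ \<i>] by (simp add: scaleR_conv_of_real mult.commute)
  then show ?thesis unfolding py_def by (rule vector_derivative_at)
qed

text \<open>\<open>(A, B, C)\<close> stands for the isotropic derivative of a minimal surface along a curve, and
  \<open>2 \<beta> (A, B, C) + E\<close> with \<open>E\<close> Hermitian-orthogonal to \<open>(A, B, C)\<close> for its derivative.\<close>
lemma isotropic_frame:
  fixes A B C E1 E2 E3 \<beta> :: complex
  assumes C: "C\<^sup>2 = A * B"
    and iso: "E1 * B + A * E2 = 2 * C * E3"
    and orth: "E1 * cnj A + E2 * cnj B + 2 * E3 * cnj C = 0"
  defines "L \<equiv> (cmod A)\<^sup>2 + (cmod B)\<^sup>2 + 2 * (cmod C)\<^sup>2"
    and "\<psi>1 \<equiv> (A + cnj B, 2 * Im C)"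
    and "\<psi>2 \<equiv> ((2 * \<beta> * A + E1) + cnj (2 * \<beta> * B + E2), 2 * Im (2 * \<beta> * C + E3))"
  shows "(norm \<psi>1)\<^sup>2 = L"
    and "\<psi>1 \<bullet> \<psi>2 = 2 * Re \<beta> * (norm \<psi>1)\<^sup>2"
    and "(norm (\<psi>2 - (2 * Re \<beta>) *\<^sub>R \<psi>1))\<^sup>2 \<le>
      4 * L * (Im \<beta>)\<^sup>2 + 2 * ((cmod E1)\<^sup>2 + (cmod E2)\<^sup>2 + 2 * (cmod E3)\<^sup>2)"
proof -
  have CR: "Re C * Re C - Im C * Im C = Re A * Re B - Im A * Im B"
    and CI: "2 * Re C * Im C = Re A * Im B + Im A * Re B"
    using C by (simp_all add: complex_eq_iff power2_eq_square mult_ac)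
  have isoR: "Re E1 * Re B - Im E1 * Im B + (Re A * Re E2 - Im A * Im E2) = 2 * (Re C * Re E3 - Im C * Im E3)"
    and isoI: "Re E1 * Im B + Im E1 * Re B + (Re A * Im E2 + Im A * Re E2) = 2 * (Re C * Im E3 + Im C * Re E3)"
    using iso by (simp_all add: complex_eq_iff algebra_simps)
  have oR: "Re E1 * Re A + Im E1 * Im A + (Re E2 * Re B + Im E2 * Im B) + 2 * (Re E3 * Re C + Im E3 * Im C) = 0"
    and oI: "Im E1 * Re A - Re E1 * Im A + (Im E2 * Re B - Re E2 * Im B) + 2 * (Im E3 * Re C - Re E3 * Im C) = 0"
    using orth by (simp_all add: complex_eq_iff algebra_simps)
  have norm_Pair2: "(norm (u, v))\<^sup>2 = (cmod u)\<^sup>2 + v\<^sup>2" for u :: complex and v :: real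
    by (simp add: norm_Pair)
  show n1: "(norm \<psi>1)\<^sup>2 = L"
    unfolding \<psi>1_def L_def norm_Pair2 cmod_power2 using CR
    by (simp add: cmod_power2 algebra_simps power2_eq_square)
  show "\<psi>1 \<bullet> \<psi>2 = 2 * Re \<beta> * (norm \<psi>1)\<^sup>2"
  proof -
    \<comment> \<open>The terms are grouped so that every bracket after the first summand vanishes
      by the real or imaginary part of one of the three relations.\<close>
    have "\<psi>1 \<bullet> \<psi>2 = 2 * Re \<beta> * L
      + 4 * Re \<beta> * ((Re A * Re B - Im A * Im B) - (Re C * Re C - Im C * Im C))
      - 4 * Im \<beta> * ((Re A * Im B + Im A * Re B) - 2 * Re C * Im C)
      + (Re E1 * Re A + Im E1 * Im A + (Re E2 * Re B + Im E2 * Im B) + 2 * (Re E3 * Re C + Im E3 * Im C))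
      + (Re E1 * Re B - Im E1 * Im B + (Re A * Re E2 - Im A * Im E2) - 2 * (Re C * Re E3 - Im C * Im E3))"
      unfolding \<psi>1_def \<psi>2_def L_def inner_Pair inner_complex_def cmod_power2
      by (simp add: algebra_simps power2_eq_square)
    then show ?thesis using CR CI isoR oR n1 by simp
  qed
  define x y where "x = Re \<beta>" and "y = Im \<beta>"
  have \<beta>: "\<beta> = Complex x y" by (simp add: x_def y_def complex_eq_iff)
  have n: "\<psi>2 - (2 * Re \<beta>) *\<^sub>R \<psi>1 =
    (2 * \<i> * y * (A - cnj B) + (E1 + cnj E2), 4 * y * Re C + 2 * Im E3)"
    unfolding \<psi>1_def \<psi>2_def \<beta> by (simp add: complex_eq_iff algebra_simps)
  have "(norm (\<psi>2 - (2 * Re \<beta>) *\<^sub>R \<psi>1))\<^sup>2 = 4 * y\<^sup>2 * L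
      + 8 * y\<^sup>2 * ((Re C * Re C - Im C * Im C) - (Re A * Re B - Im A * Im B))
      + 4 * y * ((Im E1 * Re A - Re E1 * Im A + (Im E2 * Re B - Re E2 * Im B) + 2 * (Im E3 * Re C - Re E3 * Im C)))
      - 4 * y * (Re E1 * Im B + Im E1 * Re B + (Re A * Im E2 + Im A * Re E2) - 2 * (Re C * Im E3 + Im C * Re E3))
      + (cmod (E1 + cnj E2))\<^sup>2 + 4 * (Im E3)\<^sup>2"
    unfolding n L_def norm_Pair2 cmod_power2
    by (simp add: cmod_power2 algebra_simps power2_eq_square)
  also have "\<dots> = 4 * y\<^sup>2 * L + (cmod (E1 + cnj E2))\<^sup>2 + 4 * (Im E3)\<^sup>2" using CR isoI oI by simp
  also have "(cmod (E1 + cnj E2))\<^sup>2 \<le> 2 * ((cmod E1)\<^sup>2 + (cmod E2)\<^sup>2)"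
  proof -
    have "0 \<le> (cmod (E1 - cnj E2))\<^sup>2" by simp
    then show ?thesis unfolding cmod_power2 by (simp add: algebra_simps power2_eq_square)
  qed
  also have "(Im E3)\<^sup>2 \<le> (cmod E3)\<^sup>2" unfolding cmod_power2 by simp
  finally show "(norm (\<psi>2 - (2 * Re \<beta>) *\<^sub>R \<psi>1))\<^sup>2 \<le>
      4 * L * (Im \<beta>)\<^sup>2 + 2 * ((cmod E1)\<^sup>2 + (cmod E2)\<^sup>2 + 2 * (cmod E3)\<^sup>2)"
    by (simp add: y_def algebra_simps)
qed

text \<open>The dilatation only enters through \<open>(\<Phi>')\<^sup>2 = h' g'\<close>, which makes
  \<open>\<lambda>\<^sup>2 = |h'|\<^sup>2 + |g'|\<^sup>2 + 2 |\<Phi>'|\<^sup>2\<close> smooth, also at the zeros of \<open>h'\<close> and \<open>g'\<close>.\<close>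
locale weierstrass_data =
  fixes h g \<Phi> :: "complex \<Rightarrow> complex"
  assumes h: "h holomorphic_on ball 0 1" and g: "g holomorphic_on ball 0 1"
    and \<Phi>: "\<Phi> holomorphic_on ball 0 1"
    and \<Phi>_sq: "\<And>z. z \<in> ball 0 1 \<Longrightarrow> (deriv \<Phi> z)\<^sup>2 = deriv h z * deriv g z"
    and lambda_nz: "\<And>z. z \<in> ball 0 1 \<Longrightarrow> harm_lambda h g z \<noteq> 0"
begin

abbreviation (input) "a \<equiv> deriv h"
abbreviation (input) "e \<equiv> deriv g"
abbreviation (input) "f \<equiv> deriv \<Phi>"

definition L :: "complex \<Rightarrow> real" where
  "L w = (cmod (a w))\<^sup>2 + (cmod (e w))\<^sup>2 + 2 * (cmod (f w))\<^sup>2"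

text \<open>\<open>N\<close>, \<open>N2\<close> and \<open>M\<close> are the Wirtinger derivatives
  of \<open>L\<close>: once in \<open>z\<close>, twice in \<open>z\<close>, and once each in
  \<open>z\<close> and \<open>cnj z\<close>.\<close>

definition N :: "complex \<Rightarrow> complex" where
  "N w = deriv a w * cnj (a w) + deriv e w * cnj (e w) + 2 * deriv f w * cnj (f w)"

definition N2 :: "complex \<Rightarrow> complex" where
  "N2 w = deriv (deriv a) w * cnj (a w) + deriv (deriv e) w * cnj (e w) + 2 * deriv (deriv f) w * cnj (f w)"

definition M :: "complex \<Rightarrow> real" where
  "M w = (cmod (deriv a w))\<^sup>2 + (cmod (deriv e w))\<^sup>2 + 2 * (cmod (deriv f w))\<^sup>2"

text \<open>In the notation of the paper, \<open>sig = \<sigma>\<^sub>z\<close> and \<open>sigz = \<sigma>\<^sub>z\<^sub>z\<close>; \<open>sigb\<close> is the mixed derivative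
  of \<open>\<sigma>\<close> in \<open>z\<close> and \<open>cnj z\<close>, a quarter of the Laplacian.\<close>

definition sig :: "complex \<Rightarrow> complex" where "sig w = N w / (2 * L w)"

definition sigz :: "complex \<Rightarrow> complex" where
  "sigz w = N2 w / (2 * L w) - (N w)\<^sup>2 / (2 * (L w)\<^sup>2)"

definition sigb :: "complex \<Rightarrow> real" where
  "sigb w = M w / (2 * L w) - (cmod (N w))\<^sup>2 / (2 * (L w)\<^sup>2)"

lemma dh: "z \<in> ball 0 1 \<Longrightarrow> (h has_field_derivative a z) (at z)"
  and dg: "z \<in> ball 0 1 \<Longrightarrow> (g has_field_derivative e z) (at z)"
  and d\<Phi>: "z \<in> ball 0 1 \<Longrightarrow> (\<Phi> has_field_derivative f z) (at z)"
  and da: "z \<in> ball 0 1 \<Longrightarrow> (a has_field_derivative deriv a z) (at z)"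
  and de: "z \<in> ball 0 1 \<Longrightarrow> (e has_field_derivative deriv e z) (at z)"
  and df: "z \<in> ball 0 1 \<Longrightarrow> (f has_field_derivative deriv f z) (at z)"
  and da1: "z \<in> ball 0 1 \<Longrightarrow> (deriv a has_field_derivative deriv (deriv a) z) (at z)"
  and de1: "z \<in> ball 0 1 \<Longrightarrow> (deriv e has_field_derivative deriv (deriv e) z) (at z)"
  and df1: "z \<in> ball 0 1 \<Longrightarrow> (deriv f has_field_derivative deriv (deriv f) z) (at z)"
  by (auto intro!: holomorphic_derivI[of _ "ball 0 1"] holomorphic_deriv h g \<Phi>)

lemma iso_deriv:
  assumes z: "z \<in> ball 0 1"
  shows "deriv a z * e z + a z * deriv e z = 2 * f z * deriv f z"
proof -
  have "((\<lambda>w. (f w)\<^sup>2) has_field_derivative 2 * f z * deriv f z) (at z)"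
    by (auto intro!: derivative_eq_intros df z)
  moreover have "((\<lambda>w. a w * e w) has_field_derivative deriv a z * e z + a z * deriv e z) (at z)"
    by (auto intro!: derivative_eq_intros da de z)
  then have "((\<lambda>w. (f w)\<^sup>2) has_field_derivative deriv a z * e z + a z * deriv e z) (at z)"
    by (rule has_field_derivative_transform_within_open[of _ _ _ "ball 0 1"]) (use z \<Phi>_sq in auto)
  ultimately show ?thesis by (rule DERIV_unique[symmetric])
qed

lemma lambda_sq: "z \<in> ball 0 1 \<Longrightarrow> (harm_lambda h g z)\<^sup>2 = L z"
  using arg_cong[OF \<Phi>_sq[of z], of cmod]
  by (simp add: harm_lambda_def L_def norm_mult norm_power power2_sum)

lemma lambda_pos: "z \<in> ball 0 1 \<Longrightarrow> harm_lambda h g z > 0"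
  using lambda_nz[of z] by (simp add: harm_lambda_def less_le add_nonneg_nonneg)

lemma L_pos: "z \<in> ball 0 1 \<Longrightarrow> L z > 0"
  using lambda_sq[of z] lambda_pos[of z] by (metis zero_less_power)

lemma L_deriv:
  assumes z: "z \<in> ball 0 1"
  shows "(L has_derivative (\<lambda>v. 2 * Re (N z * v))) (at z)"
proof -
  have "((\<lambda>w. Re (a w * cnj (a w) + e w * cnj (e w) + 2 * (f w * cnj (f w)))) has_derivative
     (\<lambda>v. 2 * Re (N z * v))) (at z)"
    using da[OF z] de[OF z] df[OF z] unfolding has_field_derivative_def
    by (auto intro!: derivative_eq_intros simp: N_def algebra_simps)
  then show ?thesis
    by (simp add: L_def[abs_def] complex_mult_cnj cmod_power2)
qed

lemma N_deriv:
  assumes z: "z \<in> ball 0 1"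
  shows "(N has_derivative (\<lambda>v. N2 z * v + M z * cnj v)) (at z)"
proof -
  have "of_real (M z) = deriv a z * cnj (deriv a z) + deriv e z * cnj (deriv e z) + 2 * (deriv f z * cnj (deriv f z))"
    by (simp add: M_def flip: complex_norm_square)
  then show ?thesis
    using da[OF z] de[OF z] df[OF z] da1[OF z] de1[OF z] df1[OF z] unfolding has_field_derivative_def N_def
    by (auto intro!: derivative_eq_intros simp: N2_def algebra_simps)
qed

lemma sigma_deriv:
  assumes z: "z \<in> ball 0 1"
  shows "(harm_sigma h g has_derivative (\<lambda>v. 2 * Re (sig z * v))) (at z)"
proof -
  have "((\<lambda>w. ln (L w) / 2) has_derivative (\<lambda>v. 2 * Re (sig z * v))) (at z)"
    using L_pos[OF z]
    by (auto intro!: derivative_eq_intros L_deriv z simp: sig_def field_simps Re_divide_of_real)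
  then show ?thesis
  proof (rule has_derivative_transform_within_open[of _ _ _ _ "ball 0 1"])
    fix w :: complex assume "w \<in> ball 0 1"
    then show "ln (L w) / 2 = harm_sigma h g w"
      using lambda_pos[of w] by (simp add: lambda_sq[symmetric] harm_sigma_def ln_realpow)
  qed (use z in auto)
qed

lemma sig_deriv:
  assumes z: "z \<in> ball 0 1"
  shows "(sig has_derivative (\<lambda>v. sigz z * v + sigb z * cnj v)) (at z)"
proof -
  have nn: "of_real ((cmod (N z))\<^sup>2) = N z * cnj (N z)" by (simp flip: complex_norm_square)
  have re: "of_real (2 * Re w) = w + cnj w" for w by (simp add: complex_add_cnj)
  have L: "((\<lambda>w. complex_of_real (L w)) has_derivative (\<lambda>v. N z * v + cnj (N z) * cnj v)) (at z)"
    using has_derivative_of_real[OF L_deriv[OF z], where 'a=complex]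
    unfolding re by simp
  have "((\<lambda>w. N w / (2 * complex_of_real (L w))) has_derivative
     (\<lambda>v. (N2 z * v + M z * cnj v) / (2 * L z) - N z * (N z * v + cnj (N z) * cnj v) / (2 * (L z)\<^sup>2))) (at z)"
    using L_pos[OF z]
    by (intro has_derivative_eq_rhs[OF has_derivative_divide'[OF N_deriv[OF z] has_derivative_mult_right[OF L]]])
      (auto simp: fun_eq_iff field_simps power2_eq_square)
  moreover have "(N2 z * v + M z * cnj v) / (2 * L z) - N z * (N z * v + cnj (N z) * cnj v) / (2 * (L z)\<^sup>2)
      = sigz z * v + sigb z * cnj v" for v
    unfolding sigz_def sigb_def of_real_diff of_real_divide nn
    by (simp add: diff_divide_distrib add_divide_distrib algebra_simps power2_eq_square)
  ultimately show ?thesis unfolding sig_def[abs_def] by simp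
qed

lemma schwarzian_eq:
  assumes z: "z \<in> ball 0 1"
  shows "harm_schwarzian h g z = 2 * (sigz z - (sig z)\<^sup>2)"
proof -
  define sz where "sz = dz (\<lambda>w. complex_of_real (harm_sigma h g w))"
  have sz: "sz w = sig w" if "w \<in> ball 0 1" for w
    using px_eq[OF has_derivative_of_real[OF sigma_deriv[OF that], where 'a=complex]]
      py_eq[OF has_derivative_of_real[OF sigma_deriv[OF that], where 'a=complex]]
    by (simp add: sz_def dz_def complex_eq_iff)
  have D: "(sz has_derivative (\<lambda>v. sigz z * v + sigb z * cnj v)) (at z)"
    by (rule has_derivative_transform_within_open[OF sig_deriv[OF z], of "ball 0 1"]) (use z sz in auto)
  have "dz sz z = sigz z"
    unfolding dz_def px_eq[OF D] py_eq[OF D] by (simp add: algebra_simps complex_eq_iff)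
  then show ?thesis by (simp add: harm_schwarzian_def Let_def sz_def[symmetric] sz[OF z])
qed

lemma laplacian_eq:
  assumes z: "z \<in> ball 0 1"
  shows "laplacian (harm_sigma h g) z = 4 * sigb z"
proof -
  have s: "px (harm_sigma h g) w = 2 * Re (sig w)" "py (harm_sigma h g) w = - 2 * Im (sig w)"
    if "w \<in> ball 0 1" for w
    using px_eq[OF sigma_deriv[OF that]] py_eq[OF sigma_deriv[OF that]] by simp_all
  have X: "(px (harm_sigma h g) has_derivative (\<lambda>v. 2 * Re (sigz z * v + sigb z * cnj v))) (at z)"
    by (rule has_derivative_transform_within_open[of "\<lambda>w. 2 * Re (sig w)" _ _ _ "ball 0 1"])
      (use z s in \<open>auto intro!: derivative_eq_intros sig_deriv\<close>)
  have Y: "(py (harm_sigma h g) has_derivative (\<lambda>v. - 2 * Im (sigz z * v + sigb z * cnj v))) (at z)"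
    by (rule has_derivative_transform_within_open[of "\<lambda>w. - 2 * Im (sig w)" _ _ _ "ball 0 1"])
      (use z s in \<open>auto intro!: derivative_eq_intros sig_deriv\<close>)
  show ?thesis unfolding laplacian_def px_eq[OF X] py_eq[OF Y] by simp
qed

text \<open>\<open>2 * sig z = N z / L z\<close> is the coefficient of the Hermitian projection of
  the derivative onto the isotropic vector, with weight 2 on the third coordinate. Hence the
  remainder is orthogonal, and by Pythagoras its squared length is
  \<open>M - \<bar>N\<bar>^2 / L\<close>, which carries the Gauss curvature.\<close>

lemma frame_error:
  assumes z: "z \<in> ball 0 1"
  defines "E1 \<equiv> deriv a z - 2 * sig z * a z" and "E2 \<equiv> deriv e z - 2 * sig z * e z"
    and "E3 \<equiv> deriv f z - 2 * sig z * f z"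
  shows "E1 * e z + a z * E2 = 2 * f z * E3"
    and "E1 * cnj (a z) + E2 * cnj (e z) + 2 * E3 * cnj (f z) = 0"
    and "(cmod E1)\<^sup>2 + (cmod E2)\<^sup>2 + 2 * (cmod E3)\<^sup>2 = 2 * L z * sigb z"
proof -
  have Lc: "of_real (L z) = a z * cnj (a z) + e z * cnj (e z) + 2 * (f z * cnj (f z))"
    by (simp add: L_def flip: complex_norm_square)
  have Mc: "of_real (M z) = deriv a z * cnj (deriv a z) + deriv e z * cnj (deriv e z) + 2 * (deriv f z * cnj (deriv f z))"
    by (simp add: M_def flip: complex_norm_square)
  have s: "2 * sig z * L z = N z" using L_pos[OF z] by (simp add: sig_def)
  have "E1 * e z + a z * E2 - 2 * f z * E3 =
    (deriv a z * e z + a z * deriv e z - 2 * f z * deriv f z) + 4 * sig z * ((f z)\<^sup>2 - a z * e z)"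
    by (simp add: E1_def E2_def E3_def algebra_simps power2_eq_square)
  then show "E1 * e z + a z * E2 = 2 * f z * E3"
    using iso_deriv[OF z] \<Phi>_sq[OF z] by simp
  have "E1 * cnj (a z) + E2 * cnj (e z) + 2 * E3 * cnj (f z) = N z - 2 * sig z * L z"
    unfolding E1_def E2_def E3_def N_def Lc by (simp add: algebra_simps)
  then show orth: "E1 * cnj (a z) + E2 * cnj (e z) + 2 * E3 * cnj (f z) = 0" using s by simp
  have "of_real ((cmod E1)\<^sup>2 + (cmod E2)\<^sup>2 + 2 * (cmod E3)\<^sup>2) = E1 * cnj E1 + E2 * cnj E2 + 2 * (E3 * cnj E3)"
    by (simp flip: complex_norm_square)
  also have "\<dots> = of_real (M z) - 2 * sig z * cnj (N z)
      - 2 * cnj (sig z) * (E1 * cnj (a z) + E2 * cnj (e z) + 2 * E3 * cnj (f z))"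
    unfolding E1_def E2_def E3_def N_def Mc by (simp add: algebra_simps)
  also have "\<dots> = of_real (M z - (cmod (N z))\<^sup>2 / L z)"
    unfolding orth by (simp add: sig_def flip: complex_norm_square)
  also have "M z - (cmod (N z))\<^sup>2 / L z = 2 * L z * sigb z"
    using L_pos[OF z] by (simp add: sigb_def field_simps power2_eq_square)
  finally show "(cmod E1)\<^sup>2 + (cmod E2)\<^sup>2 + 2 * (cmod E3)\<^sup>2 = 2 * L z * sigb z"
    by (simp only: of_real_eq_iff)
qed

end

section \<open>The surface along a geodesic\<close>

context weierstrass_data
begin

lemma geodesic_distortion:
  fixes W W1 k :: "real \<Rightarrow> real" and \<omega> :: complex and r s1 s2 :: real
  defines "\<gamma> \<equiv> geodesic \<omega> r" and "X \<equiv> \<lambda>z. (h z + cnj (g z), 2 * Im (\<Phi> z))"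
  assumes \<omega>: "cmod \<omega> = 1" and r: "\<bar>r\<bar> < 1" and s: "s1 < s2"
    and bound: "\<And>s. (1 - (cmod (\<gamma> s))\<^sup>2)\<^sup>2 *
      (cmod (harm_schwarzian h g (\<gamma> s)) + (harm_lambda h g (\<gamma> s))\<^sup>2 * \<bar>gauss_curvature h g (\<gamma> s)\<bar>) \<le> 2 * k s"
    and W: "\<And>s. (W has_real_derivative W1 s) (at s)"
    and W1: "\<And>s. (W1 has_real_derivative (1 - k s) * W s) (at s)"
    and W01: "\<And>s. 0 < W s" "\<And>s. W s \<le> 1"
  shows "sqrt ((harm_lambda h g (\<gamma> s1) * (1 - (cmod (\<gamma> s1))\<^sup>2)) * (harm_lambda h g (\<gamma> s2) * (1 - (cmod (\<gamma> s2))\<^sup>2)))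
      * W s1 * W s2 * (s2 - s1) \<le> norm (X (\<gamma> s2) - X (\<gamma> s1))"
proof -
  define T where "T = geodesic_deriv \<omega> r"
  define c where "c = geodesic_preschwarz r"
  note geo = geodesic_has_vector_derivative(1,2)[where \<omega>=\<omega> and r=r, folded \<gamma>_def T_def c_def]
    geodesic_has_vector_derivative(3)[where r=r, folded c_def]
  note nrm = geodesic_norm[OF \<omega> r, folded \<gamma>_def T_def]
  have z: "\<gamma> s \<in> ball 0 1" for s using nrm(2)[of s] by simp
  have Tpos: "cmod (T s) > 0" for s
    using nrm(2)[of s] by (simp add: nrm(3) abs_square_less_1)
  have chain: "((\<lambda>s. F (\<gamma> s)) has_vector_derivative d * T s) (at s)"
    if "(F has_field_derivative d) (at (\<gamma> s))" for F d s
    using field_vector_diff_chain_at[OF geo(1) that] by (simp add: o_def mult.commute)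
  have chain1: "((\<lambda>s. F (\<gamma> s) * T s) has_vector_derivative d * (T s)\<^sup>2 + F (\<gamma> s) * c s * T s) (at s)"
    if "(F has_field_derivative d) (at (\<gamma> s))" for F d s
    using has_vector_derivative_mult[OF chain[OF that] geo(2)] by (simp add: power2_eq_square algebra_simps)
  have pair: "((\<lambda>s. (u s + cnj (v s), 2 * Im (w s))) has_vector_derivative (u' + cnj v', 2 * Im w')) (at s)"
    if "(u has_vector_derivative u') (at s)" "(v has_vector_derivative v') (at s)" "(w has_vector_derivative w') (at s)"
    for u v w u' v' w' s
    using that unfolding has_vector_derivative_def
    by (auto intro!: derivative_eq_intros simp: algebra_simps scaleR_conv_of_real)
  define \<psi>1 where "\<psi>1 s = (a (\<gamma> s) * T s + cnj (e (\<gamma> s) * T s), 2 * Im (f (\<gamma> s) * T s))" for s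
  define \<psi>2 where "\<psi>2 s = ((deriv a (\<gamma> s) * (T s)\<^sup>2 + a (\<gamma> s) * c s * T s)
      + cnj (deriv e (\<gamma> s) * (T s)\<^sup>2 + e (\<gamma> s) * c s * T s),
      2 * Im (deriv f (\<gamma> s) * (T s)\<^sup>2 + f (\<gamma> s) * c s * T s))" for s
  \<comment> \<open>Half the factor by which the isotropic derivative along the curve is multiplied
    when differentiated: \<open>sig * T\<close> comes from the surface, \<open>c / 2\<close> from
    the acceleration of the geodesic. \<open>Re \<beta>\<close> is half the logarithmic derivative
    of the speed, \<open>Im \<beta>\<close> measures geodesic curvature.\<close>
  define \<beta> where "\<beta> s = sig (\<gamma> s) * T s + c s / 2" for s
  define \<beta>1 where "\<beta>1 s = sigz (\<gamma> s) * (T s)\<^sup>2 + sigb (\<gamma> s) * (T s * cnj (T s)) + sig (\<gamma> s) * c s * T s + ((c s)\<^sup>2 / 2 - 2) / 2" for s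
  have d0: "((\<lambda>s. X (\<gamma> s)) has_vector_derivative \<psi>1 s) (at s)" for s
    unfolding X_def \<psi>1_def by (intro pair chain dh dg d\<Phi> z)
  have d1: "(\<psi>1 has_vector_derivative \<psi>2 s) (at s)" for s
    unfolding \<psi>1_def[abs_def] \<psi>2_def by (intro pair chain1 da de df z)
  have d\<beta>: "(\<beta> has_vector_derivative \<beta>1 s) (at s)" for s
  proof -
    have "((\<lambda>s. sig (\<gamma> s)) has_vector_derivative sigz (\<gamma> s) * T s + sigb (\<gamma> s) * cnj (T s)) (at s)"
      using has_derivative_compose[OF geo(1)[unfolded has_vector_derivative_def] sig_deriv[OF z]]
      unfolding has_vector_derivative_def by (simp add: algebra_simps scaleR_conv_of_real)
    from has_vector_derivative_add[OF has_vector_derivative_mult[OF this geo(2)]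
        has_vector_derivative_divide[OF geo(3), of 2]]
    show ?thesis unfolding \<beta>_def[abs_def] \<beta>1_def by (simp add: algebra_simps power2_eq_square)
  qed
  have dRe: "((\<lambda>s. Re (\<beta> s)) has_real_derivative Re (\<beta>1 s)) (at s)" for s
    using bounded_linear.has_vector_derivative[OF bounded_linear_Re d\<beta>]
    by (simp add: has_real_derivative_iff_has_vector_derivative)
  define E1 where "E1 s = (deriv a (\<gamma> s) - 2 * sig (\<gamma> s) * a (\<gamma> s)) * (T s)\<^sup>2" for s
  define E2 where "E2 s = (deriv e (\<gamma> s) - 2 * sig (\<gamma> s) * e (\<gamma> s)) * (T s)\<^sup>2" for s
  define E3 where "E3 s = (deriv f (\<gamma> s) - 2 * sig (\<gamma> s) * f (\<gamma> s)) * (T s)\<^sup>2" for s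
  define V where "V s = L (\<gamma> s) * (cmod (T s))\<^sup>2" for s
  have V: "(cmod (a (\<gamma> s) * T s))\<^sup>2 + (cmod (e (\<gamma> s) * T s))\<^sup>2 + 2 * (cmod (f (\<gamma> s) * T s))\<^sup>2 = V s" for s
    by (simp add: V_def L_def norm_mult power_mult_distrib algebra_simps)
  have Vpos: "V s > 0" for s unfolding V_def using L_pos[OF z[of s]] Tpos[of s] by simp
  have \<psi>2_eq: "\<psi>2 s = ((2 * \<beta> s * (a (\<gamma> s) * T s) + E1 s) + cnj (2 * \<beta> s * (e (\<gamma> s) * T s) + E2 s),
      2 * Im (2 * \<beta> s * (f (\<gamma> s) * T s) + E3 s))" for s
  proof -
    have "deriv y (\<gamma> s) * (T s)\<^sup>2 + y (\<gamma> s) * c s * T s =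
        2 * \<beta> s * (y (\<gamma> s) * T s) + (deriv y (\<gamma> s) - 2 * sig (\<gamma> s) * y (\<gamma> s)) * (T s)\<^sup>2" for y
      by (simp add: \<beta>_def algebra_simps power2_eq_square)
    then show ?thesis unfolding \<psi>2_def E1_def E2_def E3_def by simp
  qed
  have frame: "(norm (\<psi>1 s))\<^sup>2 = V s" "\<psi>1 s \<bullet> \<psi>2 s = 2 * Re (\<beta> s) * (norm (\<psi>1 s))\<^sup>2"
    "(norm (\<psi>2 s - (2 * Re (\<beta> s)) *\<^sub>R \<psi>1 s))\<^sup>2 \<le>
      4 * V s * (Im (\<beta> s))\<^sup>2 + 2 * ((cmod (E1 s))\<^sup>2 + (cmod (E2 s))\<^sup>2 + 2 * (cmod (E3 s))\<^sup>2)" for s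
  proof -
    note fe = frame_error[OF z[of s]]
    have 1: "(f (\<gamma> s) * T s)\<^sup>2 = (a (\<gamma> s) * T s) * (e (\<gamma> s) * T s)"
      using \<Phi>_sq[OF z[of s]] by (simp add: power_mult_distrib power2_eq_square[of "T s"])
    have 2: "E1 s * (e (\<gamma> s) * T s) + (a (\<gamma> s) * T s) * E2 s = 2 * (f (\<gamma> s) * T s) * E3 s"
      using arg_cong[OF fe(1), of "\<lambda>x. x * (T s * (T s)\<^sup>2)"] unfolding E1_def E2_def E3_def by (simp add: algebra_simps)
    have 3: "E1 s * cnj (a (\<gamma> s) * T s) + E2 s * cnj (e (\<gamma> s) * T s) + 2 * E3 s * cnj (f (\<gamma> s) * T s) = 0"
    proof -
      have "E1 s * cnj (a (\<gamma> s) * T s) + E2 s * cnj (e (\<gamma> s) * T s) + 2 * E3 s * cnj (f (\<gamma> s) * T s) =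
        ((deriv a (\<gamma> s) - 2 * sig (\<gamma> s) * a (\<gamma> s)) * cnj (a (\<gamma> s)) +
        (deriv e (\<gamma> s) - 2 * sig (\<gamma> s) * e (\<gamma> s)) * cnj (e (\<gamma> s)) +
        2 * (deriv f (\<gamma> s) - 2 * sig (\<gamma> s) * f (\<gamma> s)) * cnj (f (\<gamma> s))) * ((T s)\<^sup>2 * cnj (T s))"
        unfolding E1_def E2_def E3_def complex_cnj_mult by algebra
      then show ?thesis unfolding fe(2) by simp
    qed
    note fr = isotropic_frame(1)[OF 1 2 3] isotropic_frame(2,3)[OF 1 2 3, where \<beta>="\<beta> s"]
    show "(norm (\<psi>1 s))\<^sup>2 = V s" using fr(1) unfolding V \<psi>1_def .
    show "\<psi>1 s \<bullet> \<psi>2 s = 2 * Re (\<beta> s) * (norm (\<psi>1 s))\<^sup>2" using fr(2) unfolding \<psi>2_eq \<psi>1_def .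
    show "(norm (\<psi>2 s - (2 * Re (\<beta> s)) *\<^sub>R \<psi>1 s))\<^sup>2 \<le>
      4 * V s * (Im (\<beta> s))\<^sup>2 + 2 * ((cmod (E1 s))\<^sup>2 + (cmod (E2 s))\<^sup>2 + 2 * (cmod (E3 s))\<^sup>2)"
      using fr(3) unfolding V \<psi>2_eq \<psi>1_def .
  qed
  have Esum: "(cmod (E1 s))\<^sup>2 + (cmod (E2 s))\<^sup>2 + 2 * (cmod (E3 s))\<^sup>2 = 2 * V s * sigb (\<gamma> s) * (cmod (T s))\<^sup>2" for s
  proof -
    have "(cmod (E1 s))\<^sup>2 + (cmod (E2 s))\<^sup>2 + 2 * (cmod (E3 s))\<^sup>2 =
      ((cmod (deriv a (\<gamma> s) - 2 * sig (\<gamma> s) * a (\<gamma> s)))\<^sup>2 +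
        (cmod (deriv e (\<gamma> s) - 2 * sig (\<gamma> s) * e (\<gamma> s)))\<^sup>2 +
        2 * (cmod (deriv f (\<gamma> s) - 2 * sig (\<gamma> s) * f (\<gamma> s)))\<^sup>2) * ((cmod (T s))\<^sup>2 * (cmod (T s))\<^sup>2)"
      unfolding E1_def E2_def E3_def norm_mult norm_power by algebra
    also have "\<dots> = 2 * V s * sigb (\<gamma> s) * (cmod (T s))\<^sup>2"
      unfolding frame_error(3)[OF z] V_def by (simp add: mult_ac)
    finally show ?thesis .
  qed
  have nz: "\<psi>1 s \<noteq> 0" for s using frame(1)[of s] Vpos[of s] by auto
  have curv: "Re (\<beta>1 s) - (Re (\<beta> s))\<^sup>2 + (norm (\<psi>2 s - (2 * Re (\<beta> s)) *\<^sub>R \<psi>1 s))\<^sup>2 / (4 * (norm (\<psi>1 s))\<^sup>2)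
      \<le> - (1 - k s)" for s
  proof -
    define B where "B = sigb (\<gamma> s) * (cmod (T s))\<^sup>2"
    define S where "S = (sigz (\<gamma> s) - (sig (\<gamma> s))\<^sup>2) * (T s)\<^sup>2"
    \<comment> \<open>The mixed terms \<open>sig * c * T\<close> cancel, and the constant
      \<open>-1\<close> is what remains of the Schwarzian \<open>-2\<close> of the geodesic. Taking
      real parts leaves \<open>-(Im \<beta>)^2\<close>, which the normal part in the next estimate
      compensates.\<close>
    have "\<beta>1 s - (\<beta> s)\<^sup>2 = S + of_real B - 1"
      unfolding \<beta>1_def \<beta>_def S_def B_def
      by (simp add: complex_norm_square[symmetric] field_simps power2_eq_square)
    from arg_cong[OF this, of Re] have 1: "Re (\<beta>1 s) - (Re (\<beta> s))\<^sup>2 = Re S + B - 1 - (Im (\<beta> s))\<^sup>2"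
      by (simp add: power2_eq_square)
    have 2: "(norm (\<psi>2 s - (2 * Re (\<beta> s)) *\<^sub>R \<psi>1 s))\<^sup>2 / (4 * (norm (\<psi>1 s))\<^sup>2) \<le> (Im (\<beta> s))\<^sup>2 + B"
    proof -
      have "(norm (\<psi>2 s - (2 * Re (\<beta> s)) *\<^sub>R \<psi>1 s))\<^sup>2 \<le> ((Im (\<beta> s))\<^sup>2 + B) * (4 * V s)"
        using frame(3)[of s] unfolding Esum B_def by (simp add: algebra_simps)
      then show ?thesis unfolding frame(1) using Vpos[of s] by (simp add: pos_divide_le_eq)
    qed
    have "2 * Re S \<le> cmod (harm_schwarzian h g (\<gamma> s)) * (cmod (T s))\<^sup>2"
    proof -
      have "cmod S = cmod (sigz (\<gamma> s) - (sig (\<gamma> s))\<^sup>2) * (cmod (T s))\<^sup>2"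
        by (simp add: S_def norm_mult norm_power)
      moreover have "cmod (harm_schwarzian h g (\<gamma> s)) = 2 * cmod (sigz (\<gamma> s) - (sig (\<gamma> s))\<^sup>2)"
        unfolding schwarzian_eq[OF z] norm_mult by simp
      ultimately show ?thesis using complex_Re_le_cmod[of S] by simp
    qed
    moreover have "4 * B \<le> (harm_lambda h g (\<gamma> s))\<^sup>2 * \<bar>gauss_curvature h g (\<gamma> s)\<bar> * (cmod (T s))\<^sup>2"
    proof -
      have "(harm_lambda h g (\<gamma> s))\<^sup>2 * \<bar>gauss_curvature h g (\<gamma> s)\<bar> = \<bar>4 * sigb (\<gamma> s)\<bar>"
        using lambda_pos[OF z[of s]] by (simp add: gauss_curvature_def laplacian_eq[OF z] abs_mult)
      then show ?thesis unfolding B_def by (simp add: mult_right_mono flip: mult.assoc)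
    qed
    ultimately have "2 * Re S + 4 * B \<le> 2 * k s"
      using bound[of s] by (simp add: nrm(3) algebra_simps)
    with 1 2 show ?thesis by simp
  qed
  have nv: "norm (\<psi>1 s) = harm_lambda h g (\<gamma> s) * (1 - (cmod (\<gamma> s))\<^sup>2)" for s
  proof -
    have "(norm (\<psi>1 s))\<^sup>2 = (harm_lambda h g (\<gamma> s) * cmod (T s))\<^sup>2"
      by (simp add: frame(1) V_def lambda_sq[OF z] power_mult_distrib)
    then have "norm (\<psi>1 s) = harm_lambda h g (\<gamma> s) * cmod (T s)"
      using lambda_pos[OF z[of s]] by (simp add: power2_eq_iff_nonneg)
    then show ?thesis by (simp add: nrm(3))
  qed
  show ?thesis
    using curve_distortion[OF d0 d1 nz frame(2) dRe curv W W1 W01 s] unfolding nv .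
qed

end

section \<open>The two-point estimate\<close>

lemma deriv_nehari_F:
  assumes u: "\<And>x. \<bar>x\<bar> < 1 \<Longrightarrow> (u has_real_derivative u' x) (at x)"
    and pos: "\<And>x. \<bar>x\<bar> < 1 \<Longrightarrow> u x > 0" and x: "\<bar>x\<bar> < 1"
  shows "deriv (nehari_F u) x = 1 / (u x)\<^sup>2"
proof -
  \<comment> \<open>A midpoint below 1: the integrand is known to be continuous only inside the open
    interval.\<close>
  define b where "b = (1 + \<bar>x\<bar>) / 2"
  have b: "b < 1" "\<bar>x\<bar> < b" "0 < b" using x by (simp_all add: b_def)
  have "isCont u y" "u y \<noteq> 0" if "y \<in> {- b..b}" for y
    using DERIV_isCont[OF u, of y] pos[of y] that b by (auto simp: abs_less_iff)
  then have "continuous_on {- b..b} (\<lambda>t. 1 / (u t)\<^sup>2)"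
    by (intro continuous_intros continuous_at_imp_continuous_on ballI) auto
  from has_derivative_integral_from_0[OF this, of x] b
  have "(nehari_F u has_real_derivative 1 / (u x)\<^sup>2) (at x)"
    unfolding nehari_F_def[abs_def] by (auto simp: abs_less_iff)
  then show ?thesis by (rule DERIV_imp_deriv)
qed

text \<open>The surface is handled in complex-times-real form, which is isometric to
  \<open>real^3\<close> and suits the complex calculus.\<close>

lemma dist_harm_lift:
  "norm (harm_lift h g \<Phi> z1 - harm_lift h g \<Phi> z2) =
    norm ((h z1 + cnj (g z1), 2 * Im (\<Phi> z1)) - (h z2 + cnj (g z2), 2 * Im (\<Phi> z2)))"
  by (simp add: norm_eq_sqrt_inner harm_lift_def inner_vec_def sum_3 inner_complex_def)

lemma dilatation_sqrt:
  assumes h: "h holomorphic_on ball 0 1" and g: "g holomorphic_on ball 0 1"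
    and \<Phi>: "\<Phi> holomorphic_on ball 0 1"
    and q: "meromorphic_disk q P"
    and dil: "\<forall>z\<in>ball 0 1 - P. deriv g z = deriv h z * (q z)\<^sup>2"
    and d\<Phi>: "\<forall>z\<in>ball 0 1 - P. deriv \<Phi> z = deriv h z * q z"
    and z: "z \<in> ball 0 1"
  shows "(deriv \<Phi> z)\<^sup>2 = deriv h z * deriv g z"
proof -
  define D where "D w = (deriv \<Phi> w)\<^sup>2 - deriv h w * deriv g w" for w
  have "D holomorphic_on ball 0 1"
    unfolding D_def by (intro holomorphic_intros holomorphic_deriv h g \<Phi>) auto
  then have "isCont D z"
    using z holomorphic_on_imp_continuous_on continuous_on_interior[of "ball 0 1" D z] by auto
  then have "(D \<longlongrightarrow> D z) (at z)" by (simp add: isCont_def)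
  moreover have "(D \<longlongrightarrow> 0) (at z)"
  proof (rule tendsto_eventually)
    have "\<not> z islimpt P" using q z by (auto simp: meromorphic_disk_def)
    then have "\<forall>\<^sub>F w in at z. w \<notin> P" by (simp add: islimpt_iff_eventually)
    moreover have "\<forall>\<^sub>F w in at z. w \<in> ball 0 1" using z by (intro eventually_at_in_open') auto
    ultimately show "\<forall>\<^sub>F w in at z. D w = 0"
      by eventually_elim (use dil d\<Phi> in \<open>auto simp: D_def power_mult_distrib power2_eq_square\<close>)
  qed
  ultimately have "D z = 0" by (rule tendsto_unique[rotated]) simp
  then show ?thesis by (simp add: D_def)
qed

theorem theorem3:
  fixes h g q \<Phi> :: "complex \<Rightarrow> complex" and P :: "complex set"
    and p u0 u0' :: "real \<Rightarrow> real"
  assumes h_holo: "h holomorphic_on ball 0 1"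
    and g_holo: "g holomorphic_on ball 0 1"
    and g0: "g 0 = 0"
    and lam_nz: "\<forall>z\<in>ball 0 1. harm_lambda h g z \<noteq> 0"
    and q_mero: "meromorphic_disk q P"
    and dilat: "\<forall>z\<in>ball 0 1 - P. deriv g z = deriv h z * (q z)\<^sup>2"
    and Phi_holo: "\<Phi> holomorphic_on ball 0 1"
    and Phi0: "\<Phi> 0 = 0"
    and Phi_deriv: "\<forall>z\<in>ball 0 1 - P. deriv \<Phi> z = deriv h z * q z"
    and p_ext: "extremal_nehari p"
    and bound: "\<forall>z\<in>ball 0 1. cmod (harm_schwarzian h g z)
                   + (harm_lambda h g z)\<^sup>2 * \<bar>gauss_curvature h g z\<bar> \<le> 2 * p (cmod z)"
    and u0_ode: "\<forall>x\<in>{-1<..<1}. (u0 has_real_derivative u0' x) (at x)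
                   \<and> (u0' has_real_derivative (- p x * u0 x)) (at x)"
    and u0_0: "u0 0 = 1"
    and u0'_0: "u0' 0 = 0"
  shows "\<forall>z1\<in>ball 0 1. \<forall>z2\<in>ball 0 1.
           norm (harm_lift h g \<Phi> z1 - harm_lift h g \<Phi> z2)
             \<ge> sqrt ((harm_lambda h g z1 * harm_lambda h g z2)
                     / (deriv (nehari_F u0) (cmod z1) * deriv (nehari_F u0) (cmod z2)))
               * hyp_dist z1 z2"
proof (intro ballI)
  fix z1 z2 :: complex assume z: "z1 \<in> ball 0 1" "z2 \<in> ball 0 1"
  interpret weierstrass_data h g \<Phi>
    using h_holo g_holo Phi_holo lam_nz dilatation_sqrt[OF h_holo g_holo Phi_holo q_mero dilat Phi_deriv]
    by unfold_locales auto
  have p: "nehari_function p" using p_ext by (simp add: extremal_nehari_def)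
  have u: "(u0 has_real_derivative u0' x) (at x)" "(u0' has_real_derivative (- p x * u0 x)) (at x)"
    if "\<bar>x\<bar> < 1" for x using u0_ode that by (auto simp: abs_less_iff)
  have sym: "u0 x > 0" "u0 (- x) = u0 x" if "\<bar>x\<bar> < 1" for x
    using nehari_even_solution[OF p u u0_0 u0'_0 that] by auto
  define W where "W s = cosh s * u0 (tanh s)" for s
  define W1 where "W1 s = sinh s * u0 (tanh s) + u0' (tanh s) / cosh s" for s
  define k where "k s = (1 - (tanh s)\<^sup>2)\<^sup>2 * p (tanh s)" for s
  have t: "\<bar>tanh s\<bar> < 1" for s :: real using tanh_real_gt_neg1[of s] tanh_real_lt_1[of s] by linarith
  note dW = ode_to_hyperbolic[of u0 u0' p, OF u, folded W_def W1_def k_def]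
  have Wpos: "W s > 0" and Weven: "W (- s) = W s" for s using sym[OF t[of s]] by (simp_all add: W_def)
  have W1_le: "W1 s \<le> 0" if "0 \<le> s" for s
    using extremal_solution_decreasing[OF p_ext dW(1) dW(2)[unfolded k_def] Wpos Weven _ that] by (simp add: W1_def u0'_0)
  have Wabs: "W \<bar>s\<bar> = W s" for s by (cases "0 \<le> s") (simp_all add: Weven)
  have Wdec: "W t \<le> W s" if "\<bar>s\<bar> \<le> t" for s t
  proof -
    have "W t \<le> W \<bar>s\<bar>"
      by (rule DERIV_nonpos_imp_nonincreasing[OF that]) (use dW(1) W1_le in force)
    also have "W \<bar>s\<bar> = W s" by (rule Wabs)
    finally show ?thesis .
  qed
  have W_le: "W s \<le> 1" for s
  proof -
    have "W \<bar>s\<bar> \<le> W 0" by (rule Wdec) simp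
    then show ?thesis unfolding Wabs by (simp add: W_def u0_0)
  qed
  \<comment> \<open>At the hyperbolic parameter \<open>\<tau>\<close> of \<open>cmod z\<close> this
    is an equality with \<open>W \<tau>\<close>. A point of the geodesic lies at least as far out as
    \<open>tanh s\<close>, so the decrease of \<open>W\<close> gives
    \<open>W \<tau> \<le> W s\<close>.\<close>
  have weight: "(u0 (cmod z))\<^sup>2 \<le> (1 - (cmod z)\<^sup>2) * (W s)\<^sup>2" if "cmod z < 1" "\<bar>tanh s\<bar> \<le> cmod z" for z s
  proof -
    define \<tau> where "\<tau> = artanh (cmod z)"
    have \<tau>: "tanh \<tau> = cmod z" using that by (simp add: \<tau>_def tanh_artanh_real)
    have "tanh \<bar>s\<bar> \<le> tanh \<tau>" using that by (simp add: \<tau> abs_if split: if_splits)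
    then have "W \<tau> \<le> W s" by (intro Wdec) (simp only: tanh_real_le_iff)
    then have "(W \<tau>)\<^sup>2 \<le> (W s)\<^sup>2" using Wpos[of \<tau>] by (intro power_mono) auto
    moreover have "(u0 (cmod z))\<^sup>2 = (1 - (cmod z)\<^sup>2) * (W \<tau>)\<^sup>2"
      unfolding W_def \<tau>[symmetric] one_minus_tanh_sq by (simp add: power_mult_distrib)
    ultimately show ?thesis using that by (simp add: mult_left_mono abs_square_le_1)
  qed
  show "sqrt ((harm_lambda h g z1 * harm_lambda h g z2)
      / (deriv (nehari_F u0) (cmod z1) * deriv (nehari_F u0) (cmod z2))) * hyp_dist z1 z2
    \<le> norm (harm_lift h g \<Phi> z1 - harm_lift h g \<Phi> z2)"
  proof (cases "z1 = z2")
    case True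
    then show ?thesis by (simp add: hyp_dist_def)
  next
    case False
    obtain \<omega> r s1 s2 where geo: "cmod \<omega> = 1" "\<bar>r\<bar> < 1" "s1 < s2" "geodesic \<omega> r s1 = z1"
      "geodesic \<omega> r s2 = z2" "hyp_dist z1 z2 = s2 - s1"
      by (rule geodesic_through[of z1 z2]) (use z False in auto)
    note nrm = geodesic_norm[OF geo(1,2)]
    have bd: "(1 - (cmod (geodesic \<omega> r s))\<^sup>2)\<^sup>2 * (cmod (harm_schwarzian h g (geodesic \<omega> r s))
        + (harm_lambda h g (geodesic \<omega> r s))\<^sup>2 * \<bar>gauss_curvature h g (geodesic \<omega> r s)\<bar>) \<le> 2 * k s" for s
    proof -
      define \<rho> where "\<rho> = cmod (geodesic \<omega> r s)"
      have 1: "(1 - \<rho>\<^sup>2)\<^sup>2 * (cmod (harm_schwarzian h g (geodesic \<omega> r s))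
          + (harm_lambda h g (geodesic \<omega> r s))\<^sup>2 * \<bar>gauss_curvature h g (geodesic \<omega> r s)\<bar>)
        \<le> (1 - \<rho>\<^sup>2)\<^sup>2 * (2 * p \<rho>)"
        using bound nrm(2)[of s] unfolding \<rho>_def by (intro mult_left_mono) auto
      have "(1 - \<rho>\<^sup>2)\<^sup>2 * p \<rho> \<le> (1 - \<bar>tanh s\<bar>\<^sup>2)\<^sup>2 * p \<bar>tanh s\<bar>"
        using p nrm(1,2)[of s] unfolding nehari_function_def \<rho>_def by (meson abs_ge_zero)
      moreover have "p \<bar>tanh s\<bar> = p (tanh s)"
      proof -
        have "p (- tanh s) = p (tanh s)"
          using p t[of s] by (simp add: nehari_function_def abs_less_iff)
        then show ?thesis
          by (cases "0 \<le> tanh s") (simp_all only: abs_of_nonneg abs_of_nonpos not_le less_imp_le)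
      qed
      ultimately have "(1 - \<rho>\<^sup>2)\<^sup>2 * (2 * p \<rho>) \<le> 2 * k s"
        by (simp add: k_def)
      with 1 show ?thesis unfolding \<rho>_def by linarith
    qed
    note main = geodesic_distortion[OF geo(1-3) bd dW Wpos W_le, unfolded geo(4,5)]
    \<comment> \<open>The speed of the lifted geodesic. Since \<open>1 / F' = u0^2\<close>, the
      target weight \<open>\<lambda> * u0^2\<close> is at most \<open>\<mu> * W^2\<close> at each
      endpoint, so the bound obtained along the curve is the stronger one.\<close>
    define \<mu> where "\<mu> z = harm_lambda h g z * (1 - (cmod z)\<^sup>2)" for z
    have F: "deriv (nehari_F u0) (cmod z) = 1 / (u0 (cmod z))\<^sup>2" if "cmod z < 1" for z
      using that by (intro deriv_nehari_F[OF u(1) sym(1)]) auto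
    have le: "harm_lambda h g (geodesic \<omega> r s) * (u0 (cmod (geodesic \<omega> r s)))\<^sup>2 \<le> \<mu> (geodesic \<omega> r s) * (W s)\<^sup>2" for s
    proof -
      have "geodesic \<omega> r s \<in> ball 0 1" using nrm(2) by simp
      from lambda_pos[OF this] weight[OF nrm(2,1)[of s]] show ?thesis
        unfolding \<mu>_def mult.assoc by (intro mult_left_mono) auto
    qed
    have "(harm_lambda h g z1 * harm_lambda h g z2)
      / (deriv (nehari_F u0) (cmod z1) * deriv (nehari_F u0) (cmod z2)) =
      (harm_lambda h g z1 * (u0 (cmod z1))\<^sup>2) * (harm_lambda h g z2 * (u0 (cmod z2))\<^sup>2)"
      using z by (simp add: F)
    also have "\<dots> \<le> (\<mu> z1 * (W s1)\<^sup>2) * (\<mu> z2 * (W s2)\<^sup>2)"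
    proof (rule mult_mono[OF le[of s1, unfolded geo(4)] le[of s2, unfolded geo(5)]])
      have "0 \<le> \<mu> z1"
        using lambda_pos[OF z(1)] z(1) unfolding \<mu>_def by (intro mult_nonneg_nonneg) (auto simp: abs_square_le_1)
      then show "0 \<le> \<mu> z1 * (W s1)\<^sup>2" by simp
      show "0 \<le> harm_lambda h g z2 * (u0 (cmod z2))\<^sup>2" using lambda_pos[OF z(2)] by simp
    qed
    also have "\<dots> = (\<mu> z1 * \<mu> z2) * (W s1 * W s2)\<^sup>2" by (simp add: power_mult_distrib)
    finally have "sqrt ((harm_lambda h g z1 * harm_lambda h g z2)
      / (deriv (nehari_F u0) (cmod z1) * deriv (nehari_F u0) (cmod z2))) \<le> sqrt (\<mu> z1 * \<mu> z2) * (W s1 * W s2)"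
      using Wpos[of s1] Wpos[of s2] by (metis real_sqrt_le_mono real_sqrt_mult real_sqrt_unique mult_pos_pos less_imp_le)
    then have "sqrt ((harm_lambda h g z1 * harm_lambda h g z2)
      / (deriv (nehari_F u0) (cmod z1) * deriv (nehari_F u0) (cmod z2))) * hyp_dist z1 z2
      \<le> sqrt (\<mu> z1 * \<mu> z2) * (W s1 * W s2) * (s2 - s1)"
      unfolding geo(6) using geo(3) by (intro mult_right_mono) auto
    also have "\<dots> \<le> norm (harm_lift h g \<Phi> z2 - harm_lift h g \<Phi> z1)"
      using main by (simp add: dist_harm_lift \<mu>_def mult.assoc)
    finally show ?thesis by (simp add: norm_minus_commute)
  qed
qed

end
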